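(* There exist absolute constants $C_1,C_2$ such that the following holds. Let $\mathcal F$ be a class of functions $\mathbb R^d\to\mathbb R$ and let $(x_i,y_i)_{i\in[n]}$ be i.i.d. input-output pairs in $\mathbb R^d\times[-1,1]$. Fix $\epsilon,\delta\in(0,1)$. Assume: (1) $\mathcal F=\{f_{\mathbf w}:\mathbf w\in\mathcal W\}$ with $\mathcal W\subset\mathbb R^p$, $\mathrm{diam}(\mathcal W)\le W$, and $\|f_{\mathbf w_1}-f_{\mathbf w_2}\|_\infty\le J\|\mathbf w_1-\mathbf w_2\|$ for all $\mathbf w_1,\mathbf w_2\in\mathcal W$; (2) the covariate law is $\mu=\sum_{\ell=1}^k\alpha_\ell\mu_\ell$ with each $\mu_\ell$ satisfying $c$-isoperimetry, $\alpha_\ell\ge0$, $\sum_\ell\alpha_\ell=1$, and $10^4k\log(8k/\delta)\le n\epsilon^2$; (3) $\sigma^2\equiv\mathbb E^\mu[\mathrm{Var}(y\mid x)]>0$; (4) with \[L^*:=\frac{\epsilon}{\sigma\sqrt{C_2c}}\sqrt{\frac{nd}{p\log(1+60WJ\epsilon^{-1})+\log(4/\delta)}},\] one has $d\ge C_1\frac{c(L^* )^2\sigma^2}{\epsilon^2}$. Then with probability at least $1-\delta$ over the sampling of the data, simultaneously for all $f\in\mathcal F$: \[ \frac1n\sum_{i=1}^n(f(x_i)-y_i)^2\le\sigma^2-\epsilon\ \Longrightarrow\ \mathrm{Lip}(f)\ge L^*. \] Moreover, if every $\mathbf w\in\mathcal W$ is $s$-sparse ($\|\mathbf w\|_0\le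 s$), then the same holds (with hypothesis (4) and the conclusion using this modified quantity) with $L^*$ replaced by \[ \frac{\epsilon}{\sigma\sqrt{C_2c}}\sqrt{\frac{nd}{s\log\big(p(1+60WJ\epsilon^{-1})\big)+\log(4/\delta)}}. \]
   Context: A probability measure $\nu$ on $\mathbb R^d$ satisfies $c$-isoperimetry if for every bounded $L$-Lipschitz (w.r.t. the Euclidean norm) $f:\mathbb R^d\to\mathbb R$ and every $t\ge0$, $\mathbb P_{x\sim\nu}[|f(x)-\mathbb E_\nu f|\ge t]\le 2e^{-dt^2/(2cL^2)}$. $\mathrm{Lip}(f)$ denotes the Euclidean Lipschitz constant of $f$ on $\mathbb R^d$; $\|\cdot\|$ on $\mathbb R^p$ is the Euclidean norm; $\|\mathbf w\|_0$ is the number of nonzero coordinates. *)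

theory Defs
  imports "HOL-Probability.Probability"
begin

text \<open>Points of R^d are represented as functions nat => real that are extensional
  on the index set {..<d} (so that the dimension d can be quantified inside the
  statement, which is needed for absolute constants).\<close>

definition RR :: "nat \<Rightarrow> (nat \<Rightarrow> real) set" where
  "RR d = PiE {..<d} (\<lambda>_. UNIV)"

definition Mx :: "nat \<Rightarrow> (nat \<Rightarrow> real) measure" where
  "Mx d = PiM {..<d} (\<lambda>_. borel)"

definition vnorm :: "nat \<Rightarrow> (nat \<Rightarrow> real) \<Rightarrow> real" where
  "vnorm d x = sqrt (\<Sum>i<d. (x i)^2)"

definition is_lipschitz :: "nat \<Rightarrow> real \<Rightarrow> ((nat \<Rightarrow> real) \<Rightarrow> real) \<Rightarrow> bool" where
  "is_lipschitz d L f \<longleftrightarrow>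
     (\<forall>x\<in>RR d. \<forall>y\<in>RR d. \<bar>f x - f y\<bar> \<le> L * vnorm d (\<lambda>i. x i - y i))"

definition Lip :: "nat \<Rightarrow> ((nat \<Rightarrow> real) \<Rightarrow> real) \<Rightarrow> ereal" where
  "Lip d f = Inf {ereal L | L. 0 \<le> L \<and> is_lipschitz d L f}"

definition isoperimetric :: "nat \<Rightarrow> real \<Rightarrow> (nat \<Rightarrow> real) measure \<Rightarrow> bool" where
  "isoperimetric d c \<nu> \<longleftrightarrow>
     (\<forall>f L t. bounded (f ` RR d) \<and> is_lipschitz d L f \<and> 0 \<le> t \<longrightarrow>
        measure \<nu> {x \<in> space \<nu>. \<bar>f x - (\<integral>z. f z \<partial>\<nu>)\<bar> \<ge> t}
          \<le> 2 * exp (- (real d * t^2) / (2 * c * L^2)))"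

definition Fx :: "nat \<Rightarrow> ((nat \<Rightarrow> real) \<times> real) measure \<Rightarrow> ((nat \<Rightarrow> real) \<times> real) measure" where
  "Fx d P = vimage_algebra (space P) fst (Mx d)"

definition noise_level :: "nat \<Rightarrow> ((nat \<Rightarrow> real) \<times> real) measure \<Rightarrow> real" where
  "noise_level d P =
     (\<integral>z. real_cond_exp P (Fx d P)
            (\<lambda>u. (snd u - real_cond_exp P (Fx d P) snd u)^2) z \<partial>P)"

definition robust_whp ::
  "nat \<Rightarrow> nat \<Rightarrow> ((nat \<Rightarrow> real) \<times> real) measure \<Rightarrow> (nat \<Rightarrow> real) set
   \<Rightarrow> ((nat \<Rightarrow> real) \<Rightarrow> (nat \<Rightarrow> real) \<Rightarrow> real) \<Rightarrow> real \<Rightarrow> real \<Rightarrow> real \<Rightarrow> real \<Rightarrow> bool" where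
  "robust_whp d n P W fw sigma2 \<epsilon> \<delta> L \<longleftrightarrow>
     (\<exists>A \<in> sets (PiM {..<n} (\<lambda>_. P)).
        measure (PiM {..<n} (\<lambda>_. P)) A \<ge> 1 - \<delta> \<and>
        (\<forall>S\<in>A. \<forall>w\<in>W.
           (1 / real n) * (\<Sum>i<n. (fw w (fst (S i)) - snd (S i))^2) \<le> sigma2 - \<epsilon>
           \<longrightarrow> Lip d (fw w) \<ge> ereal L))"

end

theory Submission
  imports Defs
begin

text \<open>
  Write \<open>z = y - E[y | x]\<close>. A function whose training error is below the noise level by
  \<open>\<epsilon>\<close> must have empirical correlation of order \<open>\<epsilon>\<close> with \<open>z\<close>. For an
  \<open>L\<close>-Lipschitz function, isoperimetry makes the deviation from the mean of the relevant mixture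
  component have size \<open>sqrt (c L\<^sup>2 / d)\<close>. The mean square of these deviations exceeds
  \<open>\<epsilon>\<^sup>2 / (64 \<sigma>\<^sup>2)\<close> only with probability exponentially small in
  \<open>n d \<epsilon>\<^sup>2 / (c L\<^sup>2 \<sigma>\<^sup>2)\<close> (here the lower bound on \<open>d\<close> enters), which
  pays for a union bound over a net of the parameters. By Cauchy-Schwarz against the empirical second moment of
  \<open>z\<close>, which is at most \<open>4 \<sigma>\<^sup>2\<close>, the deviations then correlate too little with \<open>z\<close>.
  The component means contribute at most the sum over the components of the absolute correlations of
  \<open>z\<close> with the component weights, a quantity independent of the function.
\<close>

section \<open>Concentration\<close>

text \<open>The sample does not reveal which mixture component a point came from, and there are
  \<open>k\<close> components to control. If each correlation were bounded by a fixed multiple of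
  \<open>\<epsilon> * n\<close>, the sum would grow with \<open>k\<close>. The bounds are therefore
  self-normalised: the correlation of the noise with the weight \<open>a l\<close> is paid for by
  the empirical second moment of that weight, plus a share
  \<open>\<epsilon> * n / (100 * k)\<close>. The second moments add up to at most \<open>n\<close>,
  because the weights at a point sum to one, and the shares are affordable by the hypothesis
  \<open>10^4 * k * ln (8 * k / \<delta>) \<le> n * \<epsilon>^2\<close>. On the Lipschitz side,
  predictors are truncated to [-1,1], since isoperimetry speaks of bounded functions only, and the
  net is chosen among the \<open>L\<close>-Lipschitz members of the class, so that its points
  concentrate as well as the functions they approximate. The exponent 5 of the covering bound and
  the value 3 of the logarithmic moment produce the absolute constants: 2560 = 5 * 512 and 1536 = 3
  * 512.\<close>

lemma prob_sum_ge_le_exp: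
  fixes \<phi> :: "'a \<Rightarrow> real"
  assumes "prob_space P" and \<phi>[measurable]: "\<phi> \<in> borel_measurable P"
    and mgf: "(\<integral>\<^sup>+ z. ennreal (exp (\<phi> z)) \<partial>P) \<le> ennreal (exp M)"
  shows "{S \<in> space (PiM {..<n} (\<lambda>_. P)). t \<le> (\<Sum>i<n. \<phi> (S i))} \<in> sets (PiM {..<n} (\<lambda>_. P))"
    and "measure (PiM {..<n} (\<lambda>_. P)) {S \<in> space (PiM {..<n} (\<lambda>_. P)). t \<le> (\<Sum>i<n. \<phi> (S i))}
           \<le> exp (real n * M - t)"
proof -
  interpret product_prob_space "\<lambda>_. P" "{..<n}"
    using assms(1) by (auto intro: product_prob_spaceI)
  let ?Q = "PiM {..<n} (\<lambda>_. P)"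
  let ?E = "{S \<in> space ?Q. t \<le> (\<Sum>i<n. \<phi> (S i))}"
  show E[measurable]: "?E \<in> sets ?Q" by measurable
  \<comment> \<open>Chernoff: on the event, \<open>exp (sum - t)\<close> is at least 1. With
    nonnegative integrals the product formula asks for no integrability.\<close>
  have "emeasure ?Q ?E = (\<integral>\<^sup>+ S. indicator ?E S \<partial>?Q)" by simp
  also have "\<dots> \<le> (\<integral>\<^sup>+ S. ennreal (exp (- t)) * (\<Prod>i<n. ennreal (exp (\<phi> (S i)))) \<partial>?Q)"
    by (intro nn_integral_mono)
       (auto simp: indicator_def prod_ennreal exp_sum[symmetric] ennreal_mult[symmetric] mult_exp_exp)
  also have "\<dots> = ennreal (exp (- t)) * (\<Prod>i<n. (\<integral>\<^sup>+ z. ennreal (exp (\<phi> z)) \<partial>P))"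
    by (simp add: nn_integral_cmult
        product_nn_integral_prod[of "{..<n}" "\<lambda>_ z. ennreal (exp (\<phi> z))", simplified])
  also have "\<dots> \<le> ennreal (exp (- t)) * (\<Prod>i<n. ennreal (exp M))"
    by (intro mult_left_mono prod_mono_ennreal mgf) auto
  also have "\<dots> = ennreal (exp (real n * M - t))"
    by (simp add: ennreal_power ennreal_mult[symmetric] exp_of_nat_mult[symmetric] mult_exp_exp)
  finally show "measure ?Q ?E \<le> exp (real n * M - t)"
    by (simp add: measure_def enn2real_leI)
qed

section \<open>Lipschitz functions and their exponential moments under isoperimetry\<close>

lemma vnorm_nonneg: "0 \<le> vnorm d x"
  by (simp add: vnorm_def sum_nonneg)

lemma is_lipschitz_mono: "is_lipschitz d L f \<Longrightarrow> L \<le> L' \<Longrightarrow> is_lipschitz d L' f"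
  unfolding is_lipschitz_def by (meson mult_right_mono order_trans vnorm_nonneg)

lemma space_Mx: "space (Mx d) = RR d"
  by (simp add: Mx_def RR_def space_PiM)

text \<open>A Lipschitz function is the infimum of the cones above its values at rational points.\<close>

lemma is_lipschitz_measurable:
  assumes "is_lipschitz d L f" "0 \<le> L"
  shows "f \<in> borel_measurable (Mx d)"
proof -
  define D where "D = PiE {..<d} (\<lambda>_. \<rat> :: real set)"
  have cD: "countable D" unfolding D_def by (intro countable_PiE) (auto simp: countable_rat)
  have DR: "D \<subseteq> RR d" unfolding D_def RR_def by auto
  have le: "\<bar>f x - f y\<bar> \<le> L * vnorm d (\<lambda>i. x i - y i)" if "x \<in> RR d" "y \<in> RR d" for x y
    using assms that by (auto simp: is_lipschitz_def)
  have ne: "D \<noteq> {}" by (auto simp: D_def PiE_eq_empty_iff intro: exI[of _ "0::real"] Rats_0)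
  have eq: "f x = (INF q\<in>D. f q + L * vnorm d (\<lambda>i. x i - q i))" if x: "x \<in> RR d" for x
  proof (rule antisym)
    show "f x \<le> (INF q\<in>D. f q + L * vnorm d (\<lambda>i. x i - q i))"
      using ne by (intro cINF_greatest) (use le[OF x] DR in \<open>force simp: abs_le_iff\<close>)+
  next
    have bdd: "bdd_below ((\<lambda>q. f q + L * vnorm d (\<lambda>i. x i - q i)) ` D)"
      by (intro bdd_belowI[of _ "f x"]) (use le[OF x] DR in \<open>force simp: abs_le_iff\<close>)
    show "(INF q\<in>D. f q + L * vnorm d (\<lambda>i. x i - q i)) \<le> f x"
    proof (rule field_le_epsilon)
      fix e :: real assume e: "0 < e"
      \<comment> \<open>This makes \<open>2 * L * (d * h) \<le> e\<close>; the added ones keep the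
        denominator positive when \<open>L\<close> or \<open>d\<close> is zero.\<close>
      define h where "h = e / (2 * (L + 1) * (real d + 1))"
      have h: "0 < h" using e assms(2) by (simp add: h_def)
      have "\<exists>q\<in>\<rat>. x i < q \<and> q < x i + h" for i
        using Rats_dense_in_real[of "x i" "x i + h"] h by auto
      then obtain r where r: "\<And>i. r i \<in> \<rat>" "\<And>i. x i < r i" "\<And>i. r i < x i + h" by metis
      define q where "q = restrict r {..<d}"
      have q: "q \<in> D" using r by (auto simp: q_def D_def)
      have "vnorm d (\<lambda>i. x i - q i) \<le> L2_set (\<lambda>i. x i - q i) {..<d}"
        by (simp add: vnorm_def L2_set_def)
      also have "\<dots> \<le> (\<Sum>i<d. \<bar>x i - q i\<bar>)" by (rule L2_set_le_sum_abs)
      also have "\<dots> \<le> (\<Sum>i<d. h)"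
      proof (rule sum_mono)
        fix i assume "i \<in> {..<d}"
        then show "\<bar>x i - q i\<bar> \<le> h" using r(2,3)[of i] by (simp add: q_def)
      qed
      also have "\<dots> = real d * h" by simp
      finally have v: "vnorm d (\<lambda>i. x i - q i) \<le> real d * h" .
      have "(INF q\<in>D. f q + L * vnorm d (\<lambda>i. x i - q i)) \<le> f q + L * vnorm d (\<lambda>i. x i - q i)"
        by (intro cINF_lower bdd q)
      also have "\<dots> \<le> f x + 2 * L * vnorm d (\<lambda>i. x i - q i)"
        using le[OF x, of q] q DR by (auto simp: abs_le_iff)
      also have "\<dots> \<le> f x + 2 * L * (real d * h)"
        using v assms(2) by (intro add_left_mono mult_left_mono) auto
      also have "2 * L * (real d * h) \<le> 2 * (L + 1) * (real d + 1) * h"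
        using h assms(2) by (simp add: algebra_simps)
      also have "\<dots> = e" using assms(2) by (simp add: h_def)
      finally show "(INF q\<in>D. f q + L * vnorm d (\<lambda>i. x i - q i)) \<le> f x + e" by simp
    qed
  qed
  have "(\<lambda>x. INF q\<in>D. f q + L * vnorm d (\<lambda>i. x i - q i)) \<in> borel_measurable (Mx d)"
  proof (rule borel_measurable_cINF[OF cD])
    fix q assume "q \<in> D"
    show "(\<lambda>x. f q + L * vnorm d (\<lambda>i. x i - q i)) \<in> borel_measurable (Mx d)"
      unfolding vnorm_def Mx_def by measurable
  next
    fix x assume "x \<in> space (Mx d)"
    then have x: "x \<in> RR d" by (simp add: space_Mx)
    show "bdd_below ((\<lambda>q. f q + L * vnorm d (\<lambda>i. x i - q i)) ` D)"
      by (intro bdd_belowI[of _ "f x"]) (use le[OF x] DR in \<open>force simp: abs_le_iff\<close>)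
  qed
  then show ?thesis
    by (subst measurable_cong[OF eq]) (auto simp: space_Mx)
qed

text \<open>Slicing \<open>V\<close> at the integers.\<close>

lemma nn_integral_exp_le_of_tail:
  assumes "prob_space \<nu>" and V[measurable]: "V \<in> borel_measurable \<nu>"
    and V0: "\<And>x. x \<in> space \<nu> \<Longrightarrow> 0 \<le> V x" and VM: "\<And>x. x \<in> space \<nu> \<Longrightarrow> V x \<le> M"
    and tail: "\<And>s. 0 \<le> s \<Longrightarrow> measure \<nu> {x \<in> space \<nu>. s \<le> V x} \<le> 2 * exp (- 2 * s)"
  shows "(\<integral>\<^sup>+ x. ennreal (exp (V x)) \<partial>\<nu>) \<le> ennreal (exp 3)"
proof -
  interpret prob_space \<nu> by fact
  define N where "N = nat \<lceil>M\<rceil>"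
  let ?A = "\<lambda>j. {x \<in> space \<nu>. real j \<le> V x}"
  have "(\<integral>\<^sup>+ x. ennreal (exp (V x)) \<partial>\<nu>)
      \<le> (\<integral>\<^sup>+ x. (\<Sum>j\<le>N. ennreal (exp (real j + 1)) * indicator (?A j) x) \<partial>\<nu>)"
  proof (intro nn_integral_mono)
    fix x assume x: "x \<in> space \<nu>"
    define j where "j = nat \<lfloor>V x\<rfloor>"
    have j: "real j \<le> V x" "V x \<le> real j + 1" using V0[OF x] by (auto simp: j_def)
    have "j \<le> N" unfolding j_def N_def using VM[OF x] by (intro nat_mono) linarith
    have "ennreal (exp (V x)) \<le> ennreal (exp (real j + 1)) * indicator (?A j) x"
      using j x by auto
    also have "\<dots> \<le> (\<Sum>j\<le>N. ennreal (exp (real j + 1)) * indicator (?A j) x)"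
      using \<open>j \<le> N\<close> by (intro member_le_sum) auto
    finally show "ennreal (exp (V x)) \<le> (\<Sum>j\<le>N. ennreal (exp (real j + 1)) * indicator (?A j) x)" .
  qed
  also have "\<dots> = (\<Sum>j\<le>N. ennreal (exp (real j + 1)) * emeasure \<nu> (?A j))"
    by (subst nn_integral_sum) (auto simp: nn_integral_cmult_indicator)
  also have "\<dots> \<le> (\<Sum>j\<le>N. ennreal (exp (real j + 1) * (2 * exp (- 2 * real j))))"
  proof (rule sum_mono)
    fix j
    have "emeasure \<nu> (?A j) \<le> ennreal (2 * exp (- 2 * real j))"
      unfolding emeasure_eq_measure by (intro ennreal_leI tail) simp
    then show "ennreal (exp (real j + 1)) * emeasure \<nu> (?A j) \<le> ennreal (exp (real j + 1) * (2 * exp (- 2 * real j)))"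
      by (subst ennreal_mult) (auto intro: mult_left_mono)
  qed
  also have "\<dots> = ennreal (\<Sum>j\<le>N. exp (real j + 1) * (2 * exp (- 2 * real j)))"
    by (intro sum_ennreal) auto
  \<comment> \<open>The slice at \<open>j\<close> contributes \<open>2 * exp (1 - j)\<close>. A
    geometric series with ratio \<open>exp (-1) \<le> 1/2\<close> gives
    \<open>4 * exp 1 \<le> exp 3\<close>, the origin of the 3.\<close>
  also have "\<dots> \<le> ennreal (exp 3)"
  proof (rule ennreal_leI)
    have half: "exp (-1) \<le> (1/2 :: real)" using exp_ge_add_one_self[of 1] by (simp add: exp_minus field_simps)
    have "(\<Sum>j\<le>N. exp (real j + 1) * (2 * exp (- 2 * real j))) = 2 * exp 1 * (\<Sum>j\<le>N. exp (-1) ^ j)"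
      unfolding sum_distrib_left
      by (intro sum.cong refl) (simp add: exp_of_nat_mult[symmetric] mult_exp_exp mult.assoc[symmetric])
    also have "\<dots> \<le> 2 * exp 1 * (\<Sum>j\<le>N. (1/2) ^ j)"
      by (intro mult_left_mono sum_mono power_mono half) auto
    also have "(\<Sum>j\<le>N. (1/2 :: real) ^ j) \<le> 2"
      by (simp add: sum_gp_basic[symmetric] sum_gp0)
    also have "2 * exp 1 * 2 \<le> exp (3::real)"
    proof -
      have "2 \<le> exp (1::real)" using exp_ge_add_one_self[of 1] by simp
      then have "2 * 2 * exp 1 \<le> exp 1 * exp 1 * exp (1::real)"
        by (intro mult_right_mono mult_mono) auto
      then show ?thesis by (simp add: mult_exp_exp)
    qed
    finally show "(\<Sum>j\<le>N. exp (real j + 1) * (2 * exp (- 2 * real j))) \<le> exp 3" by simp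
  qed
  finally show ?thesis .
qed

lemma (in prob_space) abs_integral_le_1:
  fixes f :: "'a \<Rightarrow> real"
  assumes [measurable]: "f \<in> borel_measurable M" and f1: "\<And>x. \<bar>f x\<bar> \<le> 1"
  shows "\<bar>expectation f\<bar> \<le> 1"
proof -
  have "integrable M f" by (rule integrable_const_bound[of _ 1]) (auto simp: f1)
  then have "expectation (\<lambda>x. \<bar>f x\<bar>) \<le> 1"
    by (intro integral_le_const) (auto simp: f1)
  with integral_abs_bound[of M f] show ?thesis by (rule order_trans)
qed

text \<open>A sub-Gaussian tail of \<open>f\<close> is an exponential tail of its squared deviation.
  The denominator \<open>4 * c * L^2\<close> is twice the one in isoperimetry, so the tail rate is
  2, which beats the growth of \<open>exp\<close> and leaves a bound free of \<open>d\<close>,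
  \<open>c\<close> and \<open>L\<close>.\<close>

lemma isoperimetric_exp_moment:
  assumes "prob_space \<nu>" and sets[measurable_cong]: "sets \<nu> = sets (Mx d)" and iso: "isoperimetric d c \<nu>"
    and L: "is_lipschitz d L f" "0 < L" and c: "0 < c" and d: "0 < d"
    and f1: "\<And>x. \<bar>f x\<bar> \<le> 1"
  shows "(\<integral>\<^sup>+ x. ennreal (exp (real d / (4 * c * L\<^sup>2) * (f x - (\<integral>z. f z \<partial>\<nu>))\<^sup>2)) \<partial>\<nu>) \<le> ennreal (exp 3)"
proof (rule nn_integral_exp_le_of_tail)
  interpret prob_space \<nu> by fact
  let ?m = "\<integral>z. f z \<partial>\<nu>"
  have [measurable]: "f \<in> borel_measurable (Mx d)" using L by (auto intro: is_lipschitz_measurable)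
  show "(\<lambda>x. real d / (4 * c * L\<^sup>2) * (f x - ?m)\<^sup>2) \<in> borel_measurable \<nu>" by measurable
  have m: "\<bar>?m\<bar> \<le> 1"
    by (rule abs_integral_le_1) (use f1 in auto)
  show "real d / (4 * c * L\<^sup>2) * (f x - ?m)\<^sup>2 \<le> real d / (4 * c * L\<^sup>2) * 2\<^sup>2" for x
  proof (intro mult_left_mono)
    have "\<bar>f x - ?m\<bar> \<le> 2" using m f1[of x] by linarith
    then show "(f x - ?m)\<^sup>2 \<le> 2\<^sup>2" by (simp add: abs_le_square_iff[of _ 2, simplified]) 
  qed (use c in auto)
  show "0 \<le> real d / (4 * c * L\<^sup>2) * (f x - ?m)\<^sup>2" for x using c by auto
  fix s :: real assume s: "0 \<le> s"
  define t where "t = sqrt (4 * c * L\<^sup>2 * s / real d)"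
  have t: "0 \<le> t" "t\<^sup>2 = 4 * c * L\<^sup>2 * s / real d" using s c by (auto simp: t_def)
  have bd: "bounded (f ` RR d)" by (auto simp: bounded_iff intro!: exI[of _ 1] f1)
  have eq: "{x \<in> space \<nu>. s \<le> real d / (4 * c * L\<^sup>2) * (f x - ?m)\<^sup>2} = {x \<in> space \<nu>. \<bar>f x - ?m\<bar> \<ge> t}"
  proof -
    have "s \<le> real d / (4 * c * L\<^sup>2) * (f x - ?m)\<^sup>2 \<longleftrightarrow> t \<le> \<bar>f x - ?m\<bar>" for x
    proof -
      have "t \<le> \<bar>f x - ?m\<bar> \<longleftrightarrow> t\<^sup>2 \<le> (f x - ?m)\<^sup>2"
        using t(1) abs_le_square_iff[of t "f x - ?m"] by simp
      also have "\<dots> \<longleftrightarrow> s \<le> real d / (4 * c * L\<^sup>2) * (f x - ?m)\<^sup>2"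
        unfolding t(2) using c d L(2) by (simp add: field_simps)
      finally show ?thesis by simp
    qed
    then show ?thesis by simp
  qed
  have "measure \<nu> {x \<in> space \<nu>. \<bar>f x - ?m\<bar> \<ge> t} \<le> 2 * exp (- (real d * t^2) / (2 * c * L^2))"
    using iso[unfolded isoperimetric_def] bd L(1) t(1) by blast
  also have "- (real d * t^2) / (2 * c * L^2) = - 2 * s"
    unfolding t(2) using c d L(2) by (simp add: field_simps)
  finally show "measure \<nu> {x \<in> space \<nu>. s \<le> real d / (4 * c * L\<^sup>2) * (f x - ?m)\<^sup>2} \<le> 2 * exp (- 2 * s)"
    unfolding eq .
qed fact

section \<open>Exponential moments of the noise\<close>

lemma exp_le_quadratic:
  fixes u :: real assumes "\<bar>u\<bar> \<le> 1" shows "exp u \<le> 1 + u + u\<^sup>2"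
proof (cases "0 \<le> u")
  case True then show ?thesis using assms by (intro exp_bound) auto
next
  case False
  define v where "v = - u"
  have v: "0 \<le> v" using False by (simp add: v_def)
  \<comment> \<open>With \<open>u = - v\<close> the claim is
    \<open>1 \<le> exp v * (1 - v + v^2)\<close>; the factorisation of \<open>1 + v ^ 3\<close>
    reduces it to \<open>1 + v \<le> exp v\<close>.\<close>
  have "1 \<le> 1 + v ^ 3" using v by simp
  also have "\<dots> = (1 + v) * (1 - v + v\<^sup>2)" by (simp add: algebra_simps power2_eq_square power3_eq_cube)
  also have "\<dots> \<le> exp v * (1 - v + v\<^sup>2)"
  proof (intro mult_right_mono exp_ge_add_one_self)
    have "0 \<le> (v - 1/2)\<^sup>2 + 3/4" by simp
    then show "0 \<le> 1 - v + v\<^sup>2" by (simp add: power2_eq_square algebra_simps)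
  qed
  finally have "exp (- v) * 1 \<le> exp (- v) * (exp v * (1 - v + v\<^sup>2))" by (intro mult_left_mono) auto
  then show ?thesis by (simp add: mult.assoc[symmetric] mult_exp_exp v_def)
qed

text \<open>Brings a polynomial majorant into the form that the Chernoff bound takes. The majorant
  holds almost everywhere only, because labels are bounded only almost surely.\<close>

lemma nn_integral_exp_le:
  fixes \<phi> \<psi> :: "'a \<Rightarrow> real"
  assumes "AE z in P. exp (\<phi> z) \<le> \<psi> z" "integrable P \<psi>" "(\<integral>z. \<psi> z \<partial>P) \<le> exp M"
  shows "(\<integral>\<^sup>+ z. ennreal (exp (\<phi> z)) \<partial>P) \<le> ennreal (exp M)"
proof -
  have 0: "AE z in P. 0 \<le> \<psi> z" using assms(1) by eventually_elim (meson exp_ge_zero order_trans)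
  have "(\<integral>\<^sup>+ z. ennreal (exp (\<phi> z)) \<partial>P) \<le> (\<integral>\<^sup>+ z. ennreal (\<psi> z) \<partial>P)"
    using assms(1) by (intro nn_integral_mono_AE) (auto elim!: eventually_mono intro: ennreal_leI)
  also have "\<dots> = ennreal (\<integral>z. \<psi> z \<partial>P)" by (rule nn_integral_eq_integral[OF assms(2) 0])
  also have "\<dots> \<le> ennreal (exp M)" by (rule ennreal_leI) fact
  finally show ?thesis .
qed

context prob_space begin

text \<open>As \<open>Z^2 \<le> 4\<close>, the compensator \<open>4 * l^2 * b^2\<close> absorbs the
  quadratic term of the expansion of \<open>exp\<close>. What remains is linear in \<open>Z\<close>
  with a coefficient built from \<open>b\<close> alone, and its mean vanishes by
  \<open>orth\<close>. In the application \<open>b\<close> is a function of the covariate, so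
  \<open>orth\<close> expresses that the noise has conditional mean zero. The Chernoff bound then
  controls the sum of \<open>b * Z\<close> by the empirical sum of \<open>b^2\<close>, the
  self-normalised form.\<close>

lemma mgf_orthogonal_le:
  fixes b Z :: "'a \<Rightarrow> real"
  assumes [measurable]: "Z \<in> borel_measurable M" "b \<in> borel_measurable M"
    and Z: "AE z in M. \<bar>Z z\<bar> \<le> 2" and b: "\<And>z. \<bar>b z\<bar> \<le> 1" and l: "\<bar>l\<bar> \<le> 1/2"
    and orth: "expectation (\<lambda>z. Z z * (l * b z * exp (- 4 * l\<^sup>2 * (b z)\<^sup>2))) = 0"
  shows "(\<integral>\<^sup>+ z. ennreal (exp (l * (b z * Z z) - 4 * l\<^sup>2 * (b z)\<^sup>2)) \<partial>M) \<le> ennreal (exp 0)"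
proof (rule nn_integral_exp_le)
  let ?h = "\<lambda>z. l * b z * exp (- 4 * l\<^sup>2 * (b z)\<^sup>2)"
  have h: "\<bar>?h z\<bar> \<le> 1" for z
  proof -
    have "\<bar>l\<bar> * \<bar>b z\<bar> * exp (- 4 * l\<^sup>2 * (b z)\<^sup>2) \<le> (1/2) * 1 * 1"
      using l b[of z] by (intro mult_mono) auto
    then show ?thesis by (simp add: abs_mult)
  qed
  have int: "integrable M (\<lambda>z. Z z * ?h z)"
  proof (rule integrable_const_bound[of _ 2])
    show "AE z in M. norm (Z z * ?h z) \<le> 2" using Z
    proof eventually_elim
      fix z assume "\<bar>Z z\<bar> \<le> 2"
      then have "\<bar>Z z\<bar> * \<bar>?h z\<bar> \<le> 2 * 1" using h[of z] by (intro mult_mono) auto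
      then show "norm (Z z * ?h z) \<le> 2" by (simp add: abs_mult)
    qed
  qed measurable
  show "integrable M (\<lambda>z. 1 + Z z * ?h z)" using int by simp
  show "expectation (\<lambda>z. 1 + Z z * ?h z) \<le> exp 0"
    using int orth by (simp add: prob_space)
  show "AE z in M. exp (l * (b z * Z z) - 4 * l\<^sup>2 * (b z)\<^sup>2) \<le> 1 + Z z * ?h z" using Z
  proof eventually_elim
    fix z assume Zz: "\<bar>Z z\<bar> \<le> 2"
    let ?u = "l * (b z * Z z)" and ?q = "4 * l\<^sup>2 * (b z)\<^sup>2"
    have "\<bar>l\<bar> * (\<bar>b z\<bar> * \<bar>Z z\<bar>) \<le> (1/2) * (1 * 2)"
      using l b[of z] Zz by (intro mult_mono) auto
    then have u: "\<bar>?u\<bar> \<le> 1" by (simp add: abs_mult)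
    have "(Z z)\<^sup>2 \<le> 4" using Zz abs_le_square_iff[of "Z z" 2] by simp
    then have "?u\<^sup>2 \<le> ?q" 
      using mult_left_mono[of "(Z z)\<^sup>2" 4 "l\<^sup>2 * (b z)\<^sup>2"] by (simp add: power_mult_distrib mult_ac)
    then have "exp ?u \<le> (1 + ?q) + ?u" using exp_le_quadratic[OF u] by linarith
    then have "exp ?u * exp (- ?q) \<le> ((1 + ?q) + ?u) * exp (- ?q)" by (intro mult_right_mono) auto
    also have "\<dots> = (1 + ?q) * exp (- ?q) + ?u * exp (- ?q)" by (simp add: algebra_simps)
    also have "(1 + ?q) * exp (- ?q) \<le> exp ?q * exp (- ?q)"
      by (intro mult_right_mono exp_ge_add_one_self) auto
    also have "exp ?q * exp (- ?q) = 1" by (simp add: mult_exp_exp)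
    finally show "exp (?u - ?q) \<le> 1 + Z z * ?h z"
      by (simp add: mult_exp_exp mult_ac)
  qed
qed

text \<open>Since \<open>Z^2 / 4 \<le> 1\<close>, its square is at most itself, so the logarithmic
  moment is proportional to the mean of \<open>Z^2\<close>. The resulting upper bound on the
  empirical second moment is multiplicative and stays of order \<sigma>^2 even when \<sigma> is
  small.\<close>

lemma mgf_square_upper:
  assumes [measurable]: "Z \<in> borel_measurable M" and Z: "AE z in M. \<bar>Z z\<bar> \<le> (2::real)"
  shows "(\<integral>\<^sup>+ z. ennreal (exp ((Z z)\<^sup>2 / 4)) \<partial>M) \<le> ennreal (exp (expectation (\<lambda>z. (Z z)\<^sup>2) / 2))"
proof (rule nn_integral_exp_le)
  have Z2: "AE z in M. (Z z)\<^sup>2 \<le> 4" using Z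
    by eventually_elim (use abs_le_square_iff[of _ "2::real"] in simp)
  have int: "integrable M (\<lambda>z. (Z z)\<^sup>2)"
    by (rule integrable_const_bound[of _ 4]) (use Z2 in auto)
  show "integrable M (\<lambda>z. 1 + (Z z)\<^sup>2 / 2)" using int by simp
  show "expectation (\<lambda>z. 1 + (Z z)\<^sup>2 / 2) \<le> exp (expectation (\<lambda>z. (Z z)\<^sup>2) / 2)"
    using int exp_ge_add_one_self[of "expectation (\<lambda>z. (Z z)\<^sup>2) / 2"] by (simp add: prob_space)
  show "AE z in M. exp ((Z z)\<^sup>2 / 4) \<le> 1 + (Z z)\<^sup>2 / 2" using Z2
  proof eventually_elim
    fix z assume 4: "(Z z)\<^sup>2 \<le> 4"
    let ?u = "(Z z)\<^sup>2 / 4"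
    have "?u\<^sup>2 \<le> ?u" using 4 by (intro power_le_one_iff[THEN iffD2] order_trans[OF power_decreasing[of 1 2 ?u]]) auto
    then show "exp ?u \<le> 1 + (Z z)\<^sup>2 / 2" using exp_le_quadratic[of ?u] 4 by simp
  qed
qed

text \<open>Here an additive deviation is wanted, with \<open>l\<close> of order \<epsilon>. The
  restriction \<open>l \<le> 1/4\<close> keeps the exponent within [-1,1], and
  \<open>16 * l^2\<close> bounds \<open>(l * Z^2)^2\<close>.\<close>

lemma mgf_square_lower:
  assumes [measurable]: "Z \<in> borel_measurable M" and Z: "AE z in M. \<bar>Z z\<bar> \<le> (2::real)"
    and l: "0 \<le> l" "l \<le> 1/4"
  shows "(\<integral>\<^sup>+ z. ennreal (exp (- l * (Z z)\<^sup>2)) \<partial>M)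
           \<le> ennreal (exp (- l * expectation (\<lambda>z. (Z z)\<^sup>2) + 16 * l\<^sup>2))"
proof (rule nn_integral_exp_le)
  have Z2: "AE z in M. (Z z)\<^sup>2 \<le> 4" using Z
    by eventually_elim (use abs_le_square_iff[of _ "2::real"] in simp)
  have int: "integrable M (\<lambda>z. (Z z)\<^sup>2)"
    by (rule integrable_const_bound[of _ 4]) (use Z2 in auto)
  show "integrable M (\<lambda>z. 1 + 16 * l\<^sup>2 - l * (Z z)\<^sup>2)" using int by simp
  show "expectation (\<lambda>z. 1 + 16 * l\<^sup>2 - l * (Z z)\<^sup>2) \<le> exp (- l * expectation (\<lambda>z. (Z z)\<^sup>2) + 16 * l\<^sup>2)"
    using int exp_ge_add_one_self[of "- l * expectation (\<lambda>z. (Z z)\<^sup>2) + 16 * l\<^sup>2"]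
    by (simp add: prob_space add.assoc[symmetric] del: exp_ge_add_one_self)
  show "AE z in M. exp (- l * (Z z)\<^sup>2) \<le> 1 + 16 * l\<^sup>2 - l * (Z z)\<^sup>2" using Z2
  proof eventually_elim
    fix z assume 4: "(Z z)\<^sup>2 \<le> 4"
    let ?u = "- l * (Z z)\<^sup>2"
    have a: "l * (Z z)\<^sup>2 \<le> l * 4" using l 4 by (intro mult_left_mono) auto
    have "\<bar>?u\<bar> \<le> 1" using a l by (simp add: abs_mult)
    moreover have "?u\<^sup>2 \<le> (l * 4)\<^sup>2"
      using power_mono[OF a, of 2] l(1) by simp
    ultimately show "exp ?u \<le> 1 + 16 * l\<^sup>2 - l * (Z z)\<^sup>2"
      using exp_le_quadratic[of ?u] by (simp add: power_mult_distrib)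
  qed
qed

end

section \<open>Mixture weights and the regression function\<close>

text \<open>The densities \<open>a l\<close> are fractional labels: they replace the random mixture component
  of a sample point by its conditional distribution given the point.\<close>

lemma mixture_weights:
  fixes P :: "((nat \<Rightarrow> real) \<times> real) measure"
  assumes "prob_space P" and sP[measurable_cong]: "sets P = sets (Mx d \<Otimes>\<^sub>M borel)"
    and mu: "\<And>l. l < k \<Longrightarrow> prob_space (\<mu>s l) \<and> sets (\<mu>s l) = sets (Mx d) \<and> 0 \<le> \<alpha> l"
    and sum1: "(\<Sum>l<k. \<alpha> l) = (1::real)"
    and mix: "\<And>A. A \<in> sets (Mx d) \<Longrightarrow> measure (distr P (Mx d) fst) A = (\<Sum>l<k. \<alpha> l * measure (\<mu>s l) A)"
  obtains a :: "nat \<Rightarrow> (nat \<Rightarrow> real) \<Rightarrow> real" where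
    "\<And>l. l < k \<Longrightarrow> a l \<in> borel_measurable (Mx d)"
    "\<And>l x. 0 \<le> a l x" "\<And>x. (\<Sum>l<k. a l x) = 1"
    "\<And>l F. l < k \<Longrightarrow> F \<in> borel_measurable (Mx d) \<Longrightarrow>
       (\<integral>\<^sup>+ z. ennreal (a l (fst z)) * F (fst z) \<partial>P) = ennreal (\<alpha> l) * (\<integral>\<^sup>+ x. F x \<partial>\<mu>s l)"
proof -
  interpret P: prob_space P by fact
  have fst[measurable]: "fst \<in> measurable P (Mx d)"
    by (subst measurable_cong_sets[OF sP refl]) simp
  define \<mu> where "\<mu> = distr P (Mx d) fst"
  have s\<mu>[measurable_cong]: "sets \<mu> = sets (Mx d)" by (simp add: \<mu>_def)
  have sp\<mu>: "space \<mu> = space (Mx d)" by (simp add: \<mu>_def)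
  interpret \<mu>: prob_space \<mu> unfolding \<mu>_def by (intro P.prob_space_distr fst)
  have k: "0 < k" using sum1 by (cases k) auto
  define \<nu> where "\<nu> l = density (\<mu>s l) (\<lambda>_. ennreal (\<alpha> l))" for l
  have s\<nu>: "sets (\<nu> l) = sets \<mu>" if "l < k" for l using mu[OF that] by (simp add: \<nu>_def s\<mu>)
  have em\<nu>: "emeasure (\<nu> l) A = ennreal (\<alpha> l * measure (\<mu>s l) A)" if l: "l < k" and A: "A \<in> sets \<mu>" for l A
  proof -
    interpret m: prob_space "\<mu>s l" using mu[OF l] by auto
    have "A \<in> sets (\<mu>s l)" using mu[OF l] A by (simp add: s\<mu>)
    then show ?thesis unfolding \<nu>_def using mu[OF l]
      by (simp add: emeasure_density nn_integral_cmult_indicator m.emeasure_eq_measure ennreal_mult)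
  qed
  \<comment> \<open>The mixture is a sum of nonnegative terms, so a set that is null for it is null
    for every summand.\<close>
  have ac: "absolutely_continuous \<mu> (\<nu> l)" if l: "l < k" for l
    unfolding absolutely_continuous_def
  proof
    fix A assume A: "A \<in> null_sets \<mu>"
    then have As: "A \<in> sets (Mx d)" by (auto simp: s\<mu>)
    have "measure \<mu> A = 0" using A by (simp add: null_sets_def measure_def)
    then have "(\<Sum>l<k. \<alpha> l * measure (\<mu>s l) A) = 0" using mix[OF As] by (simp add: \<mu>_def)
    then have "\<alpha> l * measure (\<mu>s l) A = 0"
      by (subst (asm) sum_nonneg_eq_0_iff) (use mu l in auto)
    then show "A \<in> null_sets (\<nu> l)" using em\<nu>[OF l] As s\<nu>[OF l] s\<mu> by (auto simp: null_sets_def)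
  qed
  define D where "D l = RN_deriv \<mu> (\<nu> l)" for l
  have Dm[measurable]: "D l \<in> borel_measurable (Mx d)" for l
    using borel_measurable_RN_deriv[of \<mu> "\<nu> l"] by (simp add: D_def measurable_cong_sets[OF s\<mu> refl])
  have D: "density \<mu> (D l) = \<nu> l" if "l < k" for l
    unfolding D_def using \<mu>.density_RN_deriv[OF ac[OF that] s\<nu>[OF that]] .
  have "AE x in \<mu>. (\<Sum>l<k. D l x) = 1"
  proof (rule \<mu>.density_unique)
    show "density \<mu> (\<lambda>x. \<Sum>l<k. D l x) = density \<mu> (\<lambda>x. 1)"
    proof (rule measure_eqI)
      fix A assume "A \<in> sets (density \<mu> (\<lambda>x. \<Sum>l<k. D l x))"
      then have A[measurable]: "A \<in> sets \<mu>" by simp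
      have "emeasure (density \<mu> (\<lambda>x. \<Sum>l<k. D l x)) A = (\<Sum>l<k. \<integral>\<^sup>+x. D l x * indicator A x \<partial>\<mu>)"
        using A by (subst emeasure_density) (simp_all add: sum_distrib_right flip: nn_integral_sum)
      also have "\<dots> = (\<Sum>l<k. emeasure (density \<mu> (D l)) A)"
        by (intro sum.cong refl) (subst emeasure_density, auto)
      also have "\<dots> = (\<Sum>l<k. ennreal (\<alpha> l * measure (\<mu>s l) A))"
        by (intro sum.cong refl) (auto simp: D em\<nu> A)
      also have "\<dots> = ennreal (\<Sum>l<k. \<alpha> l * measure (\<mu>s l) A)"
        by (intro sum_ennreal) (use mu in auto)
      also have "\<dots> = emeasure \<mu> A"
        using mix[of A] A by (simp add: s\<mu> \<mu>.emeasure_eq_measure) (simp add: \<mu>_def)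
      finally show "emeasure (density \<mu> (\<lambda>x. \<Sum>l<k. D l x)) A = emeasure (density \<mu> (\<lambda>x. 1)) A"
        by (simp add: density_1)
    qed simp
  qed measurable
  then have AE1: "AE x in \<mu>. (\<Sum>l<k. D l x) = 1" .
  \<comment> \<open>The derivatives sum to one only almost everywhere; on the exceptional null set
    all weight goes to component 0, so that the weights are a probability vector at every
    point.\<close>
  define a where "a l x = (if (\<Sum>l<k. D l x) = 1 then enn2real (D l x) else if l = 0 then 1 else 0)" for l x
  have fin: "D l x = ennreal (enn2real (D l x))" if "(\<Sum>l<k. D l x) = 1" "l < k" for l x
  proof -
    have "D l x \<le> (\<Sum>l<k. D l x)" using that by (intro member_le_sum) auto
    then have "D l x \<le> 1" using that by simp
    then show ?thesis by (metis ennreal_enn2real ennreal_one_less_top order_le_less_trans)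
  qed
  show ?thesis
  proof
    fix l assume l: "l < k"
    show "a l \<in> borel_measurable (Mx d)" unfolding a_def by measurable
    fix F :: "_ \<Rightarrow> ennreal" assume [measurable]: "F \<in> borel_measurable (Mx d)"
    have [measurable]: "a l \<in> borel_measurable (Mx d)" unfolding a_def by measurable
    have "(\<integral>\<^sup>+ z. ennreal (a l (fst z)) * F (fst z) \<partial>P) = (\<integral>\<^sup>+ x. ennreal (a l x) * F x \<partial>\<mu>)"
      unfolding \<mu>_def by (subst nn_integral_distr) auto
    also have "\<dots> = (\<integral>\<^sup>+ x. D l x * F x \<partial>\<mu>)"
    proof (rule nn_integral_cong_AE)
      show "AE x in \<mu>. ennreal (a l x) * F x = D l x * F x"
        using AE1 by eventually_elim (simp add: a_def fin[OF _ l, symmetric])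
    qed
    also have "\<dots> = (\<integral>\<^sup>+ x. F x \<partial>density \<mu> (D l))"
      by (subst nn_integral_density) auto
    also have "\<dots> = (\<integral>\<^sup>+ x. F x \<partial>\<nu> l)" by (simp add: D[OF l])
    also have "\<dots> = (\<integral>\<^sup>+ x. ennreal (\<alpha> l) * F x \<partial>\<mu>s l)"
      unfolding \<nu>_def using mu[OF l] by (subst nn_integral_density) (auto cong: measurable_cong_sets)
    also have "\<dots> = ennreal (\<alpha> l) * (\<integral>\<^sup>+ x. F x \<partial>\<mu>s l)"
      using mu[OF l] by (subst nn_integral_cmult) (auto cong: measurable_cong_sets)
    finally show "(\<integral>\<^sup>+ z. ennreal (a l (fst z)) * F (fst z) \<partial>P) = ennreal (\<alpha> l) * (\<integral>\<^sup>+ x. F x \<partial>\<mu>s l)" .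
  next
    show "0 \<le> a l x" for l x by (simp add: a_def)
  next
    fix x
    show "(\<Sum>l<k. a l x) = 1"
    proof (cases "(\<Sum>l<k. D l x) = 1")
      case True
      have "ennreal (\<Sum>l<k. a l x) = (\<Sum>l<k. ennreal (a l x))"
        by (intro sum_ennreal[symmetric]) (simp add: a_def)
      also have "\<dots> = (\<Sum>l<k. D l x)"
        by (intro sum.cong refl) (use True fin in \<open>auto simp: a_def\<close>)
      finally show ?thesis using True by simp
    next
      case False then show ?thesis using k by (simp add: a_def sum.delta)
    qed
  qed
qed

text \<open>\<open>g\<close> is the conditional expectation of the label, truncated to [-1,1]: this
  changes it on a null set and provides a bound at every sample point. Orthogonality to bounded
  functions of the covariate is the usable form of E[y - g | x] = 0, and the last clause is the
  tower property.\<close>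

lemma regression_function:
  fixes P :: "((nat \<Rightarrow> real) \<times> real) measure"
  assumes "prob_space P" and sP[measurable_cong]: "sets P = sets (Mx d \<Otimes>\<^sub>M borel)"
    and y: "AE z in P. snd z \<in> {-1..1}"
  obtains g where "g \<in> borel_measurable (Fx d P)" "g \<in> borel_measurable P" "\<And>z. \<bar>g z\<bar> \<le> 1"
    "\<And>h B. h \<in> borel_measurable (Fx d P) \<Longrightarrow> (\<And>z. \<bar>h z\<bar> \<le> B) \<Longrightarrow>
       (\<integral>z. (snd z - g z) * h z \<partial>P) = 0"
    "(\<integral>z. (snd z - g z)\<^sup>2 \<partial>P) = noise_level d P"
proof -
  interpret P: prob_space P by fact
  have fst[measurable]: "fst \<in> measurable P (Mx d)"
    by (subst measurable_cong_sets[OF sP refl]) simp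
  have snd[measurable]: "snd \<in> borel_measurable P"
    by (subst measurable_cong_sets[OF sP refl]) simp
  have sub: "subalgebra P (Fx d P)"
    unfolding subalgebra_def Fx_def using sets_image_in_sets[OF refl fst] by simp
  interpret F: finite_measure_subalgebra P "Fx d P"
    by unfold_locales (rule sub)
  define c where "c = real_cond_exp P (Fx d P) snd"
  define g where "g z = max (-1) (min 1 (c z))" for z
  have cm[measurable]: "c \<in> borel_measurable (Fx d P)" by (simp add: c_def)
  have gF: "g \<in> borel_measurable (Fx d P)" unfolding g_def by measurable
  have gP[measurable]: "g \<in> borel_measurable P" using measurable_from_subalg[OF sub gF] .
  have cP[measurable]: "c \<in> borel_measurable P" using measurable_from_subalg[OF sub cm] .
  have ints: "integrable P snd"
  proof (rule P.integrable_const_bound[of _ 1])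
    show "AE z in P. norm (snd z) \<le> 1" using y by eventually_elim auto
  qed measurable
  have cg: "AE z in P. c z = g z"
  proof -
    have "AE z in P. c z \<le> 1" unfolding c_def
      by (rule F.real_cond_exp_le_c[OF ints]) (use y in \<open>auto elim!: eventually_mono\<close>)
    moreover have "AE z in P. -1 \<le> c z" unfolding c_def
      by (rule F.real_cond_exp_ge_c[OF ints]) (use y in \<open>auto elim!: eventually_mono\<close>)
    ultimately show ?thesis by eventually_elim (auto simp: g_def)
  qed
  have g1: "\<bar>g z\<bar> \<le> 1" for z by (auto simp: g_def)
  show ?thesis
  proof (rule that[OF gF gP g1])
    fix h :: "_ \<Rightarrow> real" and B assume h: "h \<in> borel_measurable (Fx d P)" and hB: "\<And>z. \<bar>h z\<bar> \<le> B"
    have [measurable]: "h \<in> borel_measurable P" using measurable_from_subalg[OF sub h] .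
    have B: "0 \<le> B" using hB[of undefined] by linarith
    have i1: "integrable P (\<lambda>z. h z * snd z)"
    proof (rule P.integrable_const_bound[of _ B])
      show "AE z in P. norm (h z * snd z) \<le> B" using y
      proof eventually_elim
        fix z :: "(nat \<Rightarrow> real) \<times> real" assume "snd z \<in> {-1..1}"
        then have "\<bar>h z\<bar> * \<bar>snd z\<bar> \<le> B * 1" using hB[of z] B by (intro mult_mono) auto
        then show "norm (h z * snd z) \<le> B" by (simp add: abs_mult)
      qed
    qed measurable
    have i2: "integrable P (\<lambda>z. h z * g z)"
    proof (rule P.integrable_const_bound[of _ B])
      have "\<bar>h z\<bar> * \<bar>g z\<bar> \<le> B * 1" for z using hB[of z] B g1[of z] by (intro mult_mono) auto
      then show "AE z in P. norm (h z * g z) \<le> B" by (simp add: abs_mult)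
    qed measurable
    have "(\<integral>z. h z * c z \<partial>P) = (\<integral>z. h z * snd z \<partial>P)"
      unfolding c_def by (rule F.real_cond_exp_intg(2)[OF i1 h snd])
    moreover have "(\<integral>z. h z * c z \<partial>P) = (\<integral>z. h z * g z \<partial>P)"
      using cg by (intro integral_cong_AE) (auto elim!: eventually_mono)
    moreover have "(\<integral>z. (snd z - g z) * h z \<partial>P) = (\<integral>z. h z * snd z \<partial>P) - (\<integral>z. h z * g z \<partial>P)"
      using i1 i2 by (simp add: algebra_simps)
    ultimately show "(\<integral>z. (snd z - g z) * h z \<partial>P) = 0" by simp
  next
    have "AE z in P. \<bar>(snd z - g z)\<^sup>2\<bar> \<le> 4" using y
    proof eventually_elim
      fix z :: "(nat \<Rightarrow> real) \<times> real" assume "snd z \<in> {-1..1}"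
      then have "\<bar>snd z - g z\<bar> \<le> 2" using g1[of z] by auto
      then show "\<bar>(snd z - g z)\<^sup>2\<bar> \<le> 4" using abs_le_square_iff[of "snd z - g z" 2] by simp
    qed
    then have ig: "integrable P (\<lambda>z. (snd z - g z)\<^sup>2)"
      by (intro P.integrable_const_bound[of _ 4]) auto
    have ic: "integrable P (\<lambda>z. (snd z - c z)\<^sup>2)"
      using ig by (rule integrable_cong_AE_imp) (use cg in \<open>auto elim!: eventually_mono\<close>)
    have "noise_level d P = (\<integral>z. (snd z - c z)\<^sup>2 \<partial>P)"
      unfolding noise_level_def using F.real_cond_exp_int(2)[OF ic] by (simp add: c_def)
    also have "\<dots> = (\<integral>z. (snd z - g z)\<^sup>2 \<partial>P)"
      using cg by (intro integral_cong_AE) (auto elim!: eventually_mono)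
    finally show "(\<integral>z. (snd z - g z)\<^sup>2 \<partial>P) = noise_level d P" by simp
  qed
qed

section \<open>Covering numbers\<close>

text \<open>Each counted \<open>v\<close> has weight \<open>exp (card T - (\<Sum>i\<in>T. \<bar>v i\<bar>) / r) \<ge> 1\<close>, and the total weight
  of all integer vectors factorises over the coordinates.\<close>

lemma card_integer_vectors_l1_le:
  fixes r :: real
  assumes T: "finite T" and r: "0 < r"
  defines "A \<equiv> {v \<in> PiE T (\<lambda>_. UNIV :: int set). (\<Sum>i\<in>T. real_of_int \<bar>v i\<bar>) \<le> r * real (card T)}"
  shows "finite A" and "real (card A) \<le> (2 * exp 1 * (r + 1)) ^ card T"
proof -
  \<comment> \<open>A box containing all counted vectors, so that the total weight becomes a product
    of finite sums.\<close>
  define M where "M = nat \<lfloor>r * real (card T)\<rfloor>"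
  have sub: "A \<subseteq> PiE T (\<lambda>_. {- int M..int M})"
  proof
    fix v assume v: "v \<in> A"
    have "v i \<in> {- int M..int M}" if i: "i \<in> T" for i
    proof -
      have "real_of_int \<bar>v i\<bar> \<le> (\<Sum>i\<in>T. real_of_int \<bar>v i\<bar>)" using i T by (intro member_le_sum) auto
      also have "\<dots> \<le> r * real (card T)" using v by (simp add: A_def)
      finally have "\<bar>v i\<bar> \<le> \<lfloor>r * real (card T)\<rfloor>" by (simp add: le_floor_iff)
      moreover have "0 \<le> r * real (card T)" using r by simp
      ultimately show ?thesis by (auto simp: M_def)
    qed
    then show "v \<in> PiE T (\<lambda>_. {- int M..int M})" using v by (auto simp: A_def PiE_iff)
  qed
  have finP: "finite (PiE T (\<lambda>_. {- int M..int M}))" using T by (intro finite_PiE) auto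
  show "finite A" using finite_subset[OF sub finP] .
  define q where "q = exp (- 1 / r)"
  have q: "0 < q" "q < 1" using r by (auto simp: q_def)
  have "1 + 1 / r \<le> exp (1 / r)" by (rule exp_ge_add_one_self)
  then have "q \<le> r / (r + 1)" using r by (simp add: q_def exp_minus field_simps)
  then have q1: "1 / (1 - q) \<le> r + 1" using r q by (simp add: field_simps)
  define wt where "wt j = exp 1 * q ^ nat \<bar>j\<bar>" for j :: int
  have wt0: "0 \<le> wt j" for j using q by (simp add: wt_def)
  have geo: "(\<Sum>j\<le>M. exp 1 * q ^ j) \<le> exp 1 * (r + 1)"
  proof -
    have "(\<Sum>j\<le>M. q ^ j) \<le> 1 / (1 - q)" using q by (simp add: sum_gp0 divide_right_mono)
    then have "(\<Sum>j\<le>M. q ^ j) \<le> r + 1" using q1 by linarith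
    then show ?thesis by (simp add: sum_distrib_left[symmetric])
  qed
  \<comment> \<open>Treating the two signs separately counts 0 twice and produces the factor
    2.\<close>
  have "(\<Sum>j\<in>{- int M..int M}. wt j) \<le> (\<Sum>j\<in>int ` {..M} \<union> (\<lambda>j. - int j) ` {..M}. wt j)"
  proof (rule sum_mono2)
    show "{- int M..int M} \<subseteq> int ` {..M} \<union> (\<lambda>j. - int j) ` {..M}"
    proof
      fix j assume "j \<in> {- int M..int M}"
      then show "j \<in> int ` {..M} \<union> (\<lambda>j. - int j) ` {..M}"
        by (cases "0 \<le> j") (auto simp: image_iff intro!: bexI[of _ "nat \<bar>j\<bar>"])
    qed
  qed (use wt0 in auto)
  also have "\<dots> \<le> (\<Sum>j\<in>int ` {..M}. wt j) + (\<Sum>j\<in>(\<lambda>j. - int j) ` {..M}. wt j)"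
    by (subst sum_Un) (auto intro!: sum_nonneg wt0)
  also have "\<dots> = (\<Sum>j\<le>M. exp 1 * q ^ j) + (\<Sum>j\<le>M. exp 1 * q ^ j)"
    by (subst (1 2) sum.reindex) (auto simp: inj_on_def wt_def)
  also have "\<dots> \<le> 2 * exp 1 * (r + 1)" using geo by simp
  finally have tot: "(\<Sum>j\<in>{- int M..int M}. wt j) \<le> 2 * exp 1 * (r + 1)" .
  have "real (card A) = (\<Sum>v\<in>A. 1)" by simp
  also have "\<dots> \<le> (\<Sum>v\<in>A. \<Prod>i\<in>T. wt (v i))"
  proof (rule sum_mono)
    fix v assume v: "v \<in> A"
    have "q ^ nat \<bar>j\<bar> = exp (- real_of_int \<bar>j\<bar> / r)" for j
      unfolding q_def by (simp add: exp_of_nat_mult[symmetric])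
    then have "(\<Prod>i\<in>T. wt (v i)) = (\<Prod>i\<in>T. exp (1 - real_of_int \<bar>v i\<bar> / r))"
      by (simp add: wt_def mult_exp_exp)
    also have "\<dots> = exp (\<Sum>i\<in>T. 1 - real_of_int \<bar>v i\<bar> / r)" using T by (simp add: exp_sum)
    also have "(\<Sum>i\<in>T. 1 - real_of_int \<bar>v i\<bar> / r) = real (card T) - (\<Sum>i\<in>T. real_of_int \<bar>v i\<bar>) / r"
      by (simp add: sum_subtractf sum_divide_distrib)
    finally have e: "(\<Prod>i\<in>T. wt (v i)) = exp (real (card T) - (\<Sum>i\<in>T. real_of_int \<bar>v i\<bar>) / r)" .
    have "0 \<le> real (card T) - (\<Sum>i\<in>T. real_of_int \<bar>v i\<bar>) / r"
      using v r by (simp add: A_def field_simps)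
    then show "1 \<le> (\<Prod>i\<in>T. wt (v i))" unfolding e by simp
  qed
  also have "\<dots> \<le> (\<Sum>v\<in>PiE T (\<lambda>_. {- int M..int M}). \<Prod>i\<in>T. wt (v i))"
    by (intro sum_mono2 finP sub prod_nonneg wt0)
  also have "\<dots> = (\<Prod>i\<in>T. \<Sum>j\<in>{- int M..int M}. wt j)"
    by (rule prod_sum_PiE[symmetric]) (use T in auto)
  also have "\<dots> \<le> (2 * exp 1 * (r + 1)) ^ card T"
    by (simp, intro power_mono tot sum_nonneg wt0)
  finally show "real (card A) \<le> (2 * exp 1 * (r + 1)) ^ card T" .
qed

text \<open>Points are rounded to a grid and the occupied cells are counted through their l1 norm.
  Counting the cells of a box would put a factor \<open>sqrt (card T)\<close> into the base of the
  power, hence an additional logarithm of the dimension into the entropy; the l1 count avoids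
  it.\<close>

lemma finite_cover_L2_set:
  fixes V :: "('i \<Rightarrow> real) set"
  assumes T: "finite T" and \<rho>: "0 < \<rho>" and R: "0 \<le> R"
    and diam: "\<And>v w. v \<in> V \<Longrightarrow> w \<in> V \<Longrightarrow> L2_set (\<lambda>i. v i - w i) T \<le> R"
  obtains Q where "Q \<subseteq> V" "finite Q" "real (card Q) \<le> (2 * exp 1 * (R / \<rho> + 2)) ^ card T"
    "\<And>w. w \<in> V \<Longrightarrow> \<exists>q\<in>Q. L2_set (\<lambda>i. w i - q i) T \<le> \<rho>"
proof (cases "V = {}")
  case True then show ?thesis using that[of "{}"] \<rho> R by simp
next
  case False
  then obtain w0 where w0: "w0 \<in> V" by auto
  \<comment> \<open>A coordinatewise error of \<open>s\<close> is an L2 error of \<rho>. For empty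
    \<open>T\<close> the quotient is 0, hence positivity is claimed only in the presence of some
    \<open>i \<in> T\<close>.\<close>
  define s where "s = \<rho> / sqrt (real (card T))"
  define \<phi> where "\<phi> w = restrict (\<lambda>i. \<lfloor>(w i - w0 i) / s\<rfloor>) T" for w
  define r where "r = R / \<rho> + 1"
  let ?A = "{v \<in> PiE T (\<lambda>_. UNIV :: int set). (\<Sum>i\<in>T. real_of_int \<bar>v i\<bar>) \<le> r * real (card T)}"
  have r: "0 < r" using R \<rho> by (simp add: r_def add_nonneg_pos)
  have s: "0 < s" if "i \<in> T" for i using \<rho> T that by (auto simp: s_def card_gt_0_iff intro!: divide_pos_pos)
  have sub: "\<phi> ` V \<subseteq> ?A"
  proof clarify
    fix w assume w: "w \<in> V"
    have "(\<Sum>i\<in>T. real_of_int \<bar>\<phi> w i\<bar>) \<le> (\<Sum>i\<in>T. \<bar>(w i - w0 i) * 1\<bar> / s + 1)"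
    proof (rule sum_mono)
      fix i assume i: "i \<in> T"
      have "real_of_int \<bar>\<lfloor>x\<rfloor>\<bar> \<le> \<bar>x\<bar> + 1" for x :: real by linarith
      from this[of "(w i - w0 i) / s"] show "real_of_int \<bar>\<phi> w i\<bar> \<le> \<bar>(w i - w0 i) * 1\<bar> / s + 1"
        using s[OF i] i by (simp add: \<phi>_def abs_divide)
    qed
    also have "\<dots> = (\<Sum>i\<in>T. \<bar>(w i - w0 i) * 1\<bar>) / s + real (card T)"
      by (simp add: sum.distrib sum_divide_distrib)
    \<comment> \<open>Cauchy-Schwarz against the constant vector 1 costs
      \<open>sqrt (card T)\<close>; dividing by the mesh makes this exactly
      \<open>R / \<rho> * card T\<close>.\<close>
    also have "\<dots> \<le> R * sqrt (real (card T)) / s + real (card T)"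
    proof -
      have "(\<Sum>i\<in>T. \<bar>(w i - w0 i) * 1\<bar>) \<le> L2_set (\<lambda>i. w i - w0 i) T * L2_set (\<lambda>i. 1) T"
        using L2_set_mult_ineq[of "\<lambda>i. w i - w0 i" "\<lambda>_. 1" T] by (simp add: abs_mult)
      also have "\<dots> \<le> R * sqrt (real (card T))"
        using diam[OF w w0] by (intro mult_mono R) (auto simp: L2_set_def)
      finally show ?thesis using \<rho> by (intro add_right_mono divide_right_mono) (auto simp: s_def)
    qed
    also have "R * sqrt (real (card T)) / s = R / \<rho> * real (card T)"
      using \<rho> by (simp add: s_def)
    also have "\<dots> + real (card T) = r * real (card T)" by (simp add: r_def algebra_simps)
    finally show "\<phi> w \<in> PiE T (\<lambda>_. UNIV) \<and> (\<Sum>i\<in>T. real_of_int \<bar>\<phi> w i\<bar>) \<le> r * real (card T)"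
      by (simp add: \<phi>_def)
  qed
  note cnt = card_integer_vectors_l1_le[OF T r]
  have fin: "finite (\<phi> ` V)" using finite_subset[OF sub cnt(1)] .
  \<comment> \<open>One representative per occupied cell, so the net lies inside
    \<open>V\<close>.\<close>
  define Q where "Q = inv_into V \<phi> ` (\<phi> ` V)"
  show ?thesis
  proof
    show "Q \<subseteq> V" unfolding Q_def by (auto intro: inv_into_into)
    show "finite Q" unfolding Q_def by (rule finite_imageI[OF fin])
    have "card Q \<le> card (\<phi> ` V)" unfolding Q_def by (rule card_image_le[OF fin])
    also have "\<dots> \<le> card ?A" by (rule card_mono[OF cnt(1) sub])
    finally show "real (card Q) \<le> (2 * exp 1 * (R / \<rho> + 2)) ^ card T"
      using cnt(2) by (simp add: r_def add.assoc)
    fix w assume w: "w \<in> V"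
    define q where "q = inv_into V \<phi> (\<phi> w)"
    have "q \<in> Q" using w unfolding q_def Q_def by blast
    have eq: "\<phi> q = \<phi> w" unfolding q_def by (rule f_inv_into_f[of "\<phi> w" \<phi> V]) (simp add: w)
    have "\<bar>w i - q i\<bar> \<le> s" if i: "i \<in> T" for i
    proof -
      have "\<lfloor>(w i - w0 i) / s\<rfloor> = \<lfloor>(q i - w0 i) / s\<rfloor>" using fun_cong[OF eq, of i] i by (simp add: \<phi>_def)
      then have "\<bar>(w i - w0 i) / s - (q i - w0 i) / s\<bar> \<le> 1" by linarith
      then show ?thesis using s[OF i] by (simp add: diff_divide_distrib[symmetric] abs_divide)
    qed
    then have "(\<Sum>i\<in>T. (w i - q i)\<^sup>2) \<le> (\<Sum>i\<in>T. s\<^sup>2)"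
      by (intro sum_mono abs_le_square_iff[THEN iffD1]) fastforce
    also have "\<dots> \<le> \<rho>\<^sup>2" by (simp add: s_def power_divide)
    finally have "L2_set (\<lambda>i. w i - q i) T \<le> \<rho>"
      unfolding L2_set_def using \<rho> by (intro real_le_lsqrt) (auto simp: sum_nonneg)
    with \<open>q \<in> Q\<close> show "\<exists>q\<in>Q. L2_set (\<lambda>i. w i - q i) T \<le> \<rho>" by (intro bexI[where x=q])
  qed
qed

text \<open>The base \<open>2 * exp 1 * (X + 2)\<close> does not tend to 1 as
  \<open>X = R * J / \<eta>\<close> tends to 0, so it cannot be bounded by a power of
  \<open>1 + X\<close> throughout. If \<open>X \<le> 1\<close> a single point is a net; if
  \<open>X \<ge> 1\<close> the base is at most \<open>(1 + X) ^ 5\<close>.\<close>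

lemma finite_cover_scaled:
  fixes V :: "('i \<Rightarrow> real) set"
  assumes T: "finite T" and R: "0 \<le> R" and J: "0 \<le> J" and \<eta>: "0 < \<eta>"
    and diam: "\<And>v w. v \<in> V \<Longrightarrow> w \<in> V \<Longrightarrow> L2_set (\<lambda>i. v i - w i) T \<le> R"
  obtains Q where "Q \<subseteq> V" "finite Q" "real (card Q) \<le> (1 + R * J / \<eta>) ^ (5 * card T)"
    "\<And>w. w \<in> V \<Longrightarrow> \<exists>q\<in>Q. J * L2_set (\<lambda>i. w i - q i) T \<le> \<eta>"
proof (cases "V = {} \<or> R * J \<le> \<eta>")
  case True
  show ?thesis
  proof (cases "V = {}")
    case True then show ?thesis using that[of "{}"] R J \<eta> by simp
  next
    case False
    then obtain w0 where w0: "w0 \<in> V" by auto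
    have "J * L2_set (\<lambda>i. w i - w0 i) T \<le> \<eta>" if "w \<in> V" for w
      using mult_left_mono[OF diam[OF that w0] J] True False by (simp add: mult.commute)
    moreover have "1 \<le> (1 + R * J / \<eta>) ^ (5 * card T)"
      using R J \<eta> by (intro one_le_power) auto
    ultimately show ?thesis using that[of "{w0}"] w0 by auto
  qed
next
  case False
  define X where "X = R * J / \<eta>"
  have X: "1 \<le> X" using False \<eta> by (simp add: X_def)
  have J0: "0 < J" using False J \<eta> by (cases "J = 0") auto
  obtain Q where Q: "Q \<subseteq> V" "finite Q" "real (card Q) \<le> (2 * exp 1 * (R / (\<eta> / J) + 2)) ^ card T"
    "\<And>w. w \<in> V \<Longrightarrow> \<exists>q\<in>Q. L2_set (\<lambda>i. w i - q i) T \<le> \<eta> / J"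
    using finite_cover_L2_set[OF T _ R diam, of "\<eta> / J"] J0 \<eta> by auto
  have "2 * exp 1 * (X + 2) \<le> 2 * 3 * (X + 2)"
    using X exp_le by (intro mult_right_mono mult_left_mono) auto
  also have "\<dots> \<le> 16 * (1 + X)" using X by simp
  also have "\<dots> = 2 ^ 4 * (1 + X)" by simp
  also have "\<dots> \<le> (1 + X) ^ 4 * (1 + X)" using X by (intro mult_right_mono power_mono) auto
  also have "\<dots> = (1 + X) ^ 5" by (simp add: eval_nat_numeral)
  finally have b: "2 * exp 1 * (X + 2) \<le> (1 + X) ^ 5" .
  show ?thesis
  proof (rule that[OF Q(1,2)])
    have "real (card Q) \<le> (2 * exp 1 * (X + 2)) ^ card T" using Q(3) by (simp add: X_def)
    also have "\<dots> \<le> ((1 + X) ^ 5) ^ card T" using X by (intro power_mono b) auto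
    also have "\<dots> = (1 + X) ^ (5 * card T)" by (simp add: power_mult)
    finally show "real (card Q) \<le> (1 + R * J / \<eta>) ^ (5 * card T)" by (simp add: X_def)
    fix w assume "w \<in> V"
    then show "\<exists>q\<in>Q. J * L2_set (\<lambda>i. w i - q i) T \<le> \<eta>" using Q(4) J0 by (fastforce simp: field_simps)
  qed
qed

section \<open>Covers of sparse and of general parameter sets\<close>

lemma exists_enumeration_superset:
  fixes S :: "nat set"
  assumes "S \<subseteq> {..<p}" "card S \<le> s" "0 < p"
  shows "\<exists>f\<in>PiE {..<s} (\<lambda>_. {..<p}). S \<subseteq> f ` {..<s}"
proof -
  have "finite S" using assms(1) finite_subset by blast
  from ex_bij_betw_nat_finite[OF this] obtain h where h: "bij_betw h {0..<card S} S" ..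
  \<comment> \<open>Supports smaller than \<open>s\<close> are padded with the index 0, which is a
    legal value because \<open>0 < p\<close>.\<close>
  define f where "f = restrict (\<lambda>i. if i < card S then h i else 0) {..<s}"
  have "f \<in> PiE {..<s} (\<lambda>_. {..<p})"
    unfolding f_def
  proof (rule restrict_PiE_iff[THEN iffD2], rule ballI)
    fix i
    have "h i \<in> S" if "i < card S" using bij_betwE[OF h] that by simp
    then show "(if i < card S then h i else 0) \<in> {..<p}" using assms(1,3) by auto
  qed
  moreover have "S \<subseteq> f ` {..<s}"
  proof
    fix x assume "x \<in> S"
    then have "x \<in> h ` {0..<card S}" using bij_betw_imp_surj_on[OF h] by simp
    then obtain i where i: "i < card S" "x = h i" by auto
    then have "x = f i" "i < s" using assms(2) by (simp_all add: f_def)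
    then show "x \<in> f ` {..<s}" by blast
  qed
  ultimately show ?thesis by (intro bexI[where x=f])
qed

lemma vnorm_eq_L2_set:
  assumes "T \<subseteq> {..<p}" "\<And>i. i < p \<Longrightarrow> i \<notin> T \<Longrightarrow> x i = 0"
  shows "vnorm p x = L2_set x T"
proof -
  have "(\<Sum>i<p. (x i)\<^sup>2) = (\<Sum>i\<in>T. (x i)\<^sup>2)"
    using assms by (intro sum.mono_neutral_right) auto
  then show ?thesis by (simp add: vnorm_def L2_set_def)
qed

lemma power_eq_exp_ln: "0 < x \<Longrightarrow> x ^ n = exp (real n * ln (x::real))"
  using powr_realpow[of x n] by (simp add: powr_def)

text \<open>The supports are covered by the images of the \<open>p ^ s\<close> maps from
  \<open>{..<s}\<close> to \<open>{..<p}\<close>; counting maps instead of subsets also handles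
  \<open>s > p\<close>. Two vectors supported in the same image \<open>T\<close> differ only on
  \<open>T\<close>, so each class has a net with at most \<open>s\<close> coordinates in the
  exponent.\<close>

lemma sparse_cover:
  assumes V: "V \<subseteq> {w. \<forall>i\<ge>p. w i = 0}" and sp: "\<And>w. w \<in> V \<Longrightarrow> card {i. i < p \<and> w i \<noteq> 0} \<le> s"
    and R: "0 \<le> R" and J: "0 \<le> J" and \<eta>: "0 < \<eta>"
    and diam: "\<And>v w. v \<in> V \<Longrightarrow> w \<in> V \<Longrightarrow> vnorm p (\<lambda>i. v i - w i) \<le> R"
  obtains Q where "Q \<subseteq> V" "finite Q" "real (card Q) \<le> exp (5 * (real s * ln (real p * (1 + R * J / \<eta>))))"
    "\<And>w. w \<in> V \<Longrightarrow> \<exists>q\<in>Q. J * vnorm p (\<lambda>i. w i - q i) \<le> \<eta>"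
\<comment> \<open>Without coordinates the zero vector is the only candidate, and
  \<open>ln 0 = 0\<close> makes the claimed bound equal to 1.\<close>
proof (cases "p = 0")
  case True
  then have "V \<subseteq> {\<lambda>_. 0}" using V by auto
  then have "V = {} \<or> V = {\<lambda>_. 0}" by auto
  then have "finite V" "real (card V) \<le> 1" by auto
  then show ?thesis using True \<eta> by (intro that[of V]) (auto simp: vnorm_def)
next
  case False
  define X where "X = R * J / \<eta>"
  have X: "0 \<le> X" using R J \<eta> by (simp add: X_def)
  let ?F = "PiE {..<s} (\<lambda>_. {..<p})"
  define U where "U f = {w \<in> V. {i. i < p \<and> w i \<noteq> 0} \<subseteq> f ` {..<s}}" for f
  have ex: "\<exists>Q. Q \<subseteq> U f \<and> finite Q \<and> real (card Q) \<le> (1 + X) ^ (5 * s)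
      \<and> (\<forall>w\<in>U f. \<exists>q\<in>Q. J * vnorm p (\<lambda>i. w i - q i) \<le> \<eta>)" if f: "f \<in> ?F" for f
  proof -
    define T where "T = f ` {..<s}"
    have T: "finite T" "card T \<le> s" "T \<subseteq> {..<p}"
      using f card_image_le[of "{..<s}" f] by (auto simp: T_def)
    have v: "vnorm p (\<lambda>i. v i - w i) = L2_set (\<lambda>i. v i - w i) T" if "v \<in> U f" "w \<in> U f" for v w
    proof (rule vnorm_eq_L2_set[OF T(3)])
      fix i assume "i < p" "i \<notin> T"
      then have "i \<notin> {i. i < p \<and> v i \<noteq> 0}" "i \<notin> {i. i < p \<and> w i \<noteq> 0}"
        using that unfolding U_def T_def by (metis (no_types, lifting) mem_Collect_eq subsetD)+
      with \<open>i < p\<close> have "v i = 0" "w i = 0" by simp_all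
      then show "v i - w i = 0" by simp
    qed
    have d: "L2_set (\<lambda>i. v i - w i) T \<le> R" if "v \<in> U f" "w \<in> U f" for v w
      using v[OF that] diam[of v w] that by (auto simp: U_def)
    obtain Q where Q: "Q \<subseteq> U f" "finite Q" "real (card Q) \<le> (1 + R * J / \<eta>) ^ (5 * card T)"
      "\<And>w. w \<in> U f \<Longrightarrow> \<exists>q\<in>Q. J * L2_set (\<lambda>i. w i - q i) T \<le> \<eta>"
      using finite_cover_scaled[OF T(1) R J \<eta> d] by blast
    have "(1 + X) ^ (5 * card T) \<le> (1 + X) ^ (5 * s)" using T X by (intro power_increasing) auto
    then have "real (card Q) \<le> (1 + X) ^ (5 * s)" using Q(3) by (simp add: X_def)
    moreover have "\<exists>q\<in>Q. J * vnorm p (\<lambda>i. w i - q i) \<le> \<eta>" if w: "w \<in> U f" for w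
    proof -
      obtain q where "q \<in> Q" "J * L2_set (\<lambda>i. w i - q i) T \<le> \<eta>" using Q(4)[OF w] ..
      then show ?thesis using v[OF w, of q] Q(1) by (intro bexI[of _ q]) auto
    qed
    ultimately show ?thesis using Q(1,2) by (intro exI[of _ Q]) simp
  qed
  from bchoice[OF ballI, OF ex] obtain q where
    q': "\<forall>f\<in>?F. q f \<subseteq> U f \<and> finite (q f) \<and> real (card (q f)) \<le> (1 + X) ^ (5 * s)
      \<and> (\<forall>w\<in>U f. \<exists>v\<in>q f. J * vnorm p (\<lambda>i. w i - v i) \<le> \<eta>)" ..
  have q: "\<And>f. f \<in> ?F \<Longrightarrow> q f \<subseteq> U f" "\<And>f. f \<in> ?F \<Longrightarrow> finite (q f)"
    "\<And>f. f \<in> ?F \<Longrightarrow> real (card (q f)) \<le> (1 + X) ^ (5 * s)"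
    "\<And>f w. f \<in> ?F \<Longrightarrow> w \<in> U f \<Longrightarrow> \<exists>v\<in>q f. J * vnorm p (\<lambda>i. w i - v i) \<le> \<eta>"
    using q' by simp_all
  have finF: "finite ?F" by (intro finite_PiE) auto
  show ?thesis
  proof
    show "(\<Union>f\<in>?F. q f) \<subseteq> V" using q(1) unfolding U_def by blast
    show "finite (\<Union>f\<in>?F. q f)" using finF q(2) by blast
    have "real (card (\<Union>f\<in>?F. q f)) \<le> (\<Sum>f\<in>?F. real (card (q f)))"
      using card_UN_le[OF finF, of q] by (simp flip: of_nat_sum)
    also have "\<dots> \<le> (\<Sum>f\<in>?F. (1 + X) ^ (5 * s))" by (intro sum_mono q(3))
    also have "\<dots> = real p ^ s * (1 + X) ^ (5 * s)" by (simp add: card_PiE)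
    \<comment> \<open>A crude step that gives the number of supports the same exponent as the nets,
      so that both cases have entropy \<open>5 * K\<close>.\<close>
    also have "\<dots> \<le> real p ^ (5 * s) * (1 + X) ^ (5 * s)"
      using False X by (intro mult_right_mono power_increasing) auto
    also have "\<dots> = (real p * (1 + X)) ^ (5 * s)" by (simp add: power_mult_distrib)
    also have "\<dots> = exp (5 * (real s * ln (real p * (1 + X))))"
      using False X power_eq_exp_ln[of "real p * (1 + X)" "5 * s"] by (simp add: mult.assoc)
    finally show "real (card (\<Union>f\<in>?F. q f)) \<le> exp (5 * (real s * ln (real p * (1 + R * J / \<eta>))))"
      by (simp add: X_def)
    fix w assume w: "w \<in> V"
    obtain f where f: "f \<in> ?F" "{i. i < p \<and> w i \<noteq> 0} \<subseteq> f ` {..<s}"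
      using exists_enumeration_superset[of "{i. i < p \<and> w i \<noteq> 0}" p s] sp[OF w] False by auto
    then show "\<exists>q\<in>\<Union>f\<in>?F. q f. J * vnorm p (\<lambda>i. w i - q i) \<le> \<eta>"
      using q(4)[OF f(1), of w] w by (auto simp: U_def)
  qed
qed

lemma dense_cover:
  assumes R: "0 \<le> R" and J: "0 \<le> J" and \<eta>: "0 < \<eta>"
    and diam: "\<And>v w. v \<in> V \<Longrightarrow> w \<in> V \<Longrightarrow> vnorm p (\<lambda>i. v i - w i) \<le> R"
  obtains Q where "Q \<subseteq> V" "finite Q" "real (card Q) \<le> exp (5 * (real p * ln (1 + R * J / \<eta>)))"
    "\<And>w. w \<in> V \<Longrightarrow> \<exists>q\<in>Q. J * vnorm p (\<lambda>i. w i - q i) \<le> \<eta>"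
proof -
  have v: "vnorm p x = L2_set x {..<p}" for x by (simp add: vnorm_def L2_set_def)
  have "0 < 1 + R * J / \<eta>" using R J \<eta> by (simp add: add_pos_nonneg)
  then have e: "(1 + R * J / \<eta>) ^ (5 * card {..<p}) = exp (5 * (real p * ln (1 + R * J / \<eta>)))"
    using power_eq_exp_ln[of "1 + R * J / \<eta>" "5 * p"] by (simp add: mult.assoc)
  show ?thesis
    using finite_cover_scaled[of "{..<p}" R J \<eta> V] R J \<eta> diam that unfolding v e by blast
qed

section \<open>The law of robustness\<close>

lemma weighted_mean_square_le:
  fixes a u :: "'i \<Rightarrow> real"
  assumes "\<And>l. l \<in> I \<Longrightarrow> 0 \<le> a l" "sum a I = 1"
  shows "(\<Sum>l\<in>I. a l * u l)\<^sup>2 \<le> (\<Sum>l\<in>I. a l * (u l)\<^sup>2)"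
proof -
  let ?m = "\<Sum>l\<in>I. a l * u l"
  have "0 \<le> (\<Sum>l\<in>I. a l * (u l - ?m)\<^sup>2)" using assms(1) by (intro sum_nonneg) auto
  also have "\<dots> = (\<Sum>l\<in>I. a l * (u l)\<^sup>2 - 2 * ?m * (a l * u l) + ?m\<^sup>2 * a l)"
    by (intro sum.cong refl) (simp add: power2_eq_square algebra_simps)
  also have "\<dots> = (\<Sum>l\<in>I. a l * (u l)\<^sup>2) - 2 * ?m * ?m + ?m\<^sup>2 * sum a I"
    by (simp only: sum.distrib sum_subtractf sum_distrib_left[symmetric])
  finally show ?thesis using assms(2) by (simp add: power2_eq_square)
qed

lemma exp_weighted_mean_le:
  fixes a u :: "'i \<Rightarrow> real"
  assumes "\<And>l. l \<in> I \<Longrightarrow> 0 \<le> a l" "sum a I = 1"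
  shows "exp (\<Sum>l\<in>I. a l * u l) \<le> (\<Sum>l\<in>I. a l * exp (u l))"
proof -
  let ?m = "\<Sum>l\<in>I. a l * u l"
  \<comment> \<open>The factor is 1, written as the weighted sum of the tangent-line values
    \<open>1 + (u l - ?m)\<close>.\<close>
  have "exp ?m = exp ?m * (sum a I + ?m - ?m * sum a I)" using assms(2) by simp
  also have "sum a I + ?m - ?m * sum a I = (\<Sum>l\<in>I. a l * (1 + (u l - ?m)))"
    by (simp add: algebra_simps sum.distrib sum_subtractf sum_distrib_left[symmetric] sum_distrib_right[symmetric])
  also have "exp ?m * \<dots> = (\<Sum>l\<in>I. a l * (exp ?m * (1 + (u l - ?m))))"
    by (simp add: sum_distrib_left mult_ac)
  also have "\<dots> \<le> (\<Sum>l\<in>I. a l * (exp ?m * exp (u l - ?m)))"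
    by (intro sum_mono mult_left_mono assms(1) exp_ge_add_one_self) auto
  also have "\<dots> = (\<Sum>l\<in>I. a l * exp (u l))" by (simp add: mult_exp_exp)
  finally show ?thesis .
qed

text \<open>Expanding the square gives a lower bound on the correlation of the noise \<open>z = y - g\<close> with
  \<open>q\<close>. Splitting \<open>q\<close> into its deviation from the component means \<open>m l\<close> and the means
  themselves, Cauchy-Schwarz bounds the first part; centring of the products is not needed.\<close>

lemma no_fit_below_noise:
  fixes y g f q :: "nat \<Rightarrow> real" and a :: "nat \<Rightarrow> nat \<Rightarrow> real" and m :: "nat \<Rightarrow> real"
  defines "z \<equiv> \<lambda>i. y i - g i"
  assumes n: "0 < n" and eps: "0 < \<epsilon>" and s2: "0 < s2" and k: "0 < k"
    and y1: "\<And>i. i < n \<Longrightarrow> \<bar>y i\<bar> \<le> 1" and g1: "\<And>i. i < n \<Longrightarrow> \<bar>g i\<bar> \<le> 1"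
    and fq: "\<And>i. i < n \<Longrightarrow> \<bar>f i - q i\<bar> \<le> \<epsilon> / 60"
    and a0: "\<And>l i. 0 \<le> a l i" and a1: "\<And>i. (\<Sum>l<k. a l i) = 1"
    and m1: "\<And>l. l < k \<Longrightarrow> \<bar>m l\<bar> \<le> 1"
    and z2_lower: "real n * (s2 - \<epsilon> / 6) < (\<Sum>i<n. (z i)\<^sup>2)"
    and z2_upper: "(\<Sum>i<n. (z i)\<^sup>2) < 4 * real n * s2"
    and gz: "- (\<Sum>i<n. g i * z i) \<le> \<epsilon> / 20 * real n"
    and az: "\<And>l. l < k \<Longrightarrow> \<bar>\<Sum>i<n. a l i * z i\<bar> \<le> \<epsilon> / 25 * (\<Sum>i<n. (a l i)\<^sup>2) + \<epsilon> * real n / (100 * real k)"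
    and dev: "(\<Sum>i<n. \<Sum>l<k. a l i * (q i - m l)\<^sup>2) \<le> real n * \<epsilon>\<^sup>2 / (64 * s2)"
  shows "real n * (s2 - \<epsilon>) < (\<Sum>i<n. (f i - y i)\<^sup>2)"
proof (rule ccontr)
  assume "\<not> ?thesis"
  then have fit: "(\<Sum>i<n. (f i - y i)\<^sup>2) \<le> real n * (s2 - \<epsilon>)" by simp
  have "(\<Sum>i<n. (z i)\<^sup>2) + 2 * (\<Sum>i<n. g i * z i) - 2 * (\<Sum>i<n. f i * z i)
      = (\<Sum>i<n. (z i)\<^sup>2 + 2 * (g i * z i) - 2 * (f i * z i))"
    by (simp only: sum.distrib sum_subtractf sum_distrib_left)
  also have "\<dots> \<le> (\<Sum>i<n. (f i - y i)\<^sup>2)"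
  proof (rule sum_mono)
    fix i
    have "(f i - y i)\<^sup>2 = (z i)\<^sup>2 + 2 * (g i * z i) - 2 * (f i * z i) + (g i - f i)\<^sup>2"
      by (simp add: z_def power2_eq_square algebra_simps)
    then show "(z i)\<^sup>2 + 2 * (g i * z i) - 2 * (f i * z i) \<le> (f i - y i)\<^sup>2" by simp
  qed
  finally have 1: "real n * (s2 - \<epsilon> / 6) - \<epsilon> / 10 * real n - real n * (s2 - \<epsilon>) \<le> 2 * (\<Sum>i<n. f i * z i)"
    using fit z2_lower gz by linarith
  have "(\<Sum>i<n. f i * z i) - (\<Sum>i<n. q i * z i) = (\<Sum>i<n. (f i - q i) * z i)"
    by (simp add: sum_subtractf[symmetric] algebra_simps)
  also have "\<dots> \<le> (\<Sum>i<n. \<epsilon> / 60 * 2)"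
  proof (rule sum_mono)
    fix i assume "i \<in> {..<n}"
    then have "\<bar>f i - q i\<bar> * \<bar>z i\<bar> \<le> \<epsilon> / 60 * 2"
      using fq[of i] y1[of i] g1[of i] eps by (intro mult_mono) (auto simp: z_def)
    then show "(f i - q i) * z i \<le> \<epsilon> / 60 * 2" by (simp add: abs_mult[symmetric] abs_le_iff)
  qed
  finally have 2: "(\<Sum>i<n. f i * z i) - (\<Sum>i<n. q i * z i) \<le> \<epsilon> / 30 * real n"
    by (simp add: mult.commute)
  define u where "u i = (\<Sum>l<k. a l i * (q i - m l))" for i
  have split: "(\<Sum>i<n. q i * z i) = (\<Sum>i<n. z i * u i) + (\<Sum>l<k. m l * (\<Sum>i<n. a l i * z i))"
  proof -
    have "q i * z i = z i * u i + (\<Sum>l<k. m l * (a l i * z i))" for i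
    proof -
      have "z i * u i + (\<Sum>l<k. m l * (a l i * z i)) = (\<Sum>l<k. z i * (a l i * (q i - m l)) + m l * (a l i * z i))"
        by (simp add: u_def sum_distrib_left sum.distrib)
      also have "\<dots> = (\<Sum>l<k. q i * z i * a l i)" by (intro sum.cong refl) (simp add: algebra_simps)
      also have "\<dots> = q i * z i" by (simp add: sum_distrib_left[symmetric] a1)
      finally show ?thesis ..
    qed
    then have "(\<Sum>i<n. q i * z i) = (\<Sum>i<n. z i * u i) + (\<Sum>i<n. \<Sum>l<k. m l * (a l i * z i))"
      by (simp add: sum.distrib)
    also have "(\<Sum>i<n. \<Sum>l<k. m l * (a l i * z i)) = (\<Sum>l<k. m l * (\<Sum>i<n. a l i * z i))"
      by (subst sum.swap) (simp add: sum_distrib_left)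
    finally show ?thesis .
  qed
  \<comment> \<open>The constants 4 and 64 of the hypotheses combine to 4/64 = (1/4)^2, and the two
    factors \<open>s2\<close> cancel.\<close>
  have 3: "(\<Sum>i<n. z i * u i) \<le> \<epsilon> / 4 * real n"
  proof (rule power2_le_imp_le)
    have u2: "(\<Sum>i<n. (u i)\<^sup>2) \<le> real n * \<epsilon>\<^sup>2 / (64 * s2)"
    proof (rule order_trans[OF sum_mono dev])
      fix i
      show "(u i)\<^sup>2 \<le> (\<Sum>l<k. a l i * (q i - m l)\<^sup>2)"
        unfolding u_def by (rule weighted_mean_square_le) (auto simp: a0 a1)
    qed
    have "(\<Sum>i<n. z i * u i)\<^sup>2 \<le> (\<Sum>i<n. (z i)\<^sup>2) * (\<Sum>i<n. (u i)\<^sup>2)"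
      by (rule Cauchy_Schwarz_ineq_sum)
    also have "\<dots> \<le> (4 * real n * s2) * (real n * \<epsilon>\<^sup>2 / (64 * s2))"
      using z2_upper u2 s2 by (intro mult_mono) (auto intro: sum_nonneg)
    also have "\<dots> = (\<epsilon> / 4 * real n)\<^sup>2" using s2 by (simp add: field_simps power2_eq_square)
    finally show "(\<Sum>i<n. z i * u i)\<^sup>2 \<le> (\<epsilon> / 4 * real n)\<^sup>2" .
  qed (use eps in simp)
  have "(\<Sum>l<k. m l * (\<Sum>i<n. a l i * z i))
      \<le> (\<Sum>l<k. \<epsilon> / 25 * (\<Sum>i<n. (a l i)\<^sup>2) + \<epsilon> * real n / (100 * real k))"
  proof (rule sum_mono)
    fix l assume "l \<in> {..<k}"
    then have l: "l < k" by simp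
    have "\<bar>m l\<bar> * \<bar>\<Sum>i<n. a l i * z i\<bar> \<le> 1 * \<bar>\<Sum>i<n. a l i * z i\<bar>"
      using m1[OF l] by (intro mult_right_mono) auto
    then have "m l * (\<Sum>i<n. a l i * z i) \<le> \<bar>\<Sum>i<n. a l i * z i\<bar>"
      by (simp add: abs_mult[symmetric] abs_le_iff)
    then show "m l * (\<Sum>i<n. a l i * z i) \<le> \<epsilon> / 25 * (\<Sum>i<n. (a l i)\<^sup>2) + \<epsilon> * real n / (100 * real k)"
      using az[OF l] by linarith
  qed
  \<comment> \<open>Self-normalisation pays off: at each point the squared weights sum to at most 1,
    so all \<open>k\<close> components together cost \<open>n\<close> once.\<close>
  also have "\<dots> = \<epsilon> / 25 * (\<Sum>i<n. \<Sum>l<k. (a l i)\<^sup>2) + \<epsilon> * real n / 100"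
    using k by (subst sum.swap) (simp add: sum.distrib sum_distrib_left)
  also have "(\<Sum>i<n. \<Sum>l<k. (a l i)\<^sup>2) \<le> (\<Sum>i<n. \<Sum>l<k. a l i)"
  proof (intro sum_mono)
    fix i l assume "l \<in> {..<k}"
    then have "a l i \<le> (\<Sum>l<k. a l i)" using a0 by (intro member_le_sum) auto
    then have "a l i * a l i \<le> a l i * 1" using a0 by (intro mult_left_mono) (auto simp: a1)
    then show "(a l i)\<^sup>2 \<le> a l i" by (simp add: power2_eq_square)
  qed
  also have "(\<Sum>i<n. \<Sum>l<k. a l i) = real n" by (simp add: a1)
  finally have 4: "(\<Sum>l<k. m l * (\<Sum>i<n. a l i * z i)) \<le> \<epsilon> / 25 * real n + \<epsilon> * real n / 100"
    using eps by simp
  \<comment> \<open>The contradiction is 11/15 <= 2 * (1/30 + 1/4 + 1/25 + 1/100) = 2/3, where 11/15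
    = 1 - 1/6 - 1/10.\<close>
  define e where "e = \<epsilon> * real n"
  have "0 < e" using eps n by (simp add: e_def)
  moreover have "real n * (s2 - \<epsilon> / 6) - \<epsilon> / 10 * real n - real n * (s2 - \<epsilon>) = 11/15 * e"
    by (simp add: e_def algebra_simps)
  moreover have "\<epsilon> / 30 * real n = e / 30" "\<epsilon> / 4 * real n = e / 4" "\<epsilon> / 25 * real n = e / 25"
    by (simp_all add: e_def)
  ultimately show False using 1 2 3 4 split by (simp add: e_def[symmetric])
qed

section \<open>Truncated predictors and the probabilistic argument\<close>

definition clip :: "real \<Rightarrow> real" where
  "clip t = max (- 1) (min 1 t)"

lemma abs_clip_le: "\<bar>clip t\<bar> \<le> 1"
  by (auto simp: clip_def)

lemma abs_clip_diff_le: "\<bar>clip s - clip t\<bar> \<le> \<bar>s - t\<bar>"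
  by (auto simp: clip_def)

lemma is_lipschitz_clip: "is_lipschitz d L f \<Longrightarrow> is_lipschitz d L (\<lambda>x. clip (f x))"
  unfolding is_lipschitz_def by (meson abs_clip_diff_le order_trans)

text \<open>Truncation to an interval that contains the label moves the prediction no farther from
  it. A predictor that fits below the noise level therefore still does so after truncation, where it
  is bounded and has component means in [-1,1].\<close>

lemma clip_square_le: "\<bar>y\<bar> \<le> 1 \<Longrightarrow> (clip t - y)\<^sup>2 \<le> (t - y)\<^sup>2"
proof (rule abs_le_square_iff[THEN iffD1])
  assume "\<bar>y\<bar> \<le> 1"
  then show "\<bar>clip t - y\<bar> \<le> \<bar>t - y\<bar>" unfolding clip_def min_def max_def by (auto split: if_splits)
qed

lemma is_lipschitz_of_Lip_less: "Lip d f < ereal L \<Longrightarrow> is_lipschitz d L f"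
proof -
  assume "Lip d f < ereal L"
  then obtain L' where "is_lipschitz d L' f" "L' < L" unfolding Lip_def Inf_less_iff by auto
  then show ?thesis by (intro is_lipschitz_mono[of d L' f L]) auto
qed

lemma Lip_nonneg: "0 \<le> Lip d f"
  unfolding Lip_def by (rule Inf_greatest) auto

text \<open>Training error and \<open>Lip\<close> are both nonnegative, so these cases hold on the
  whole sample space. The main argument may then assume \<open>0 < L\<close> and
  \<open>\<epsilon> \<le> \<sigma>^2\<close>.\<close>

lemma robust_whp_trivial:
  assumes "prob_space P" "0 < \<delta>" and "L \<le> 0 \<or> s2 < \<epsilon>"
  shows "robust_whp d n P W fw s2 \<epsilon> \<delta> L"
proof -
  let ?Q = "PiM {..<n} (\<lambda>_. P)"
  interpret Q: prob_space ?Q using assms(1) by (intro prob_space_PiM)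
  have "Lip d (fw w) \<ge> ereal L"
    if "1 / real n * (\<Sum>i<n. (fw w (fst (S i)) - snd (S i))\<^sup>2) \<le> s2 - \<epsilon>" for w and S :: "nat \<Rightarrow> (nat \<Rightarrow> real) \<times> real"
  proof -
    have "0 \<le> 1 / real n * (\<Sum>i<n. (fw w (fst (S i)) - snd (S i))\<^sup>2)" by (simp add: sum_nonneg)
    then have "L \<le> 0" using that assms(3) by linarith
    then have "ereal L \<le> 0" by simp
    then show ?thesis using Lip_nonneg by (rule order_trans)
  qed
  then show ?thesis
    unfolding robust_whp_def using assms(2) by (intro bexI[of _ "space ?Q"]) (auto simp: Q.prob_space)
qed

text \<open>Jensen with the weights \<open>a l x\<close> takes the sum over components out of the
  exponential; \<open>aint\<close> then turns each term into an integral over its own component,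
  where isoperimetry applies. Because the \<alpha> sum to one, the bound does not depend on
  \<open>k\<close>.\<close>

lemma mixture_exp_moment:
  fixes P :: "((nat \<Rightarrow> real) \<times> real) measure" and F :: "(nat \<Rightarrow> real) \<Rightarrow> real"
  assumes sP[measurable_cong]: "sets P = sets (Mx d \<Otimes>\<^sub>M borel)"
    and mu: "\<And>l. l < k \<Longrightarrow> prob_space (\<mu>s l) \<and> sets (\<mu>s l) = sets (Mx d)
              \<and> isoperimetric d c (\<mu>s l) \<and> 0 \<le> \<alpha> l"
    and sum1: "(\<Sum>l<k. \<alpha> l) = (1::real)"
    and am: "\<And>l. l < k \<Longrightarrow> a l \<in> borel_measurable (Mx d)"
    and a0: "\<And>l x. 0 \<le> a l x" and a1: "\<And>x. (\<Sum>l<k. a l x) = 1"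
    and aint: "\<And>l F. l < k \<Longrightarrow> F \<in> borel_measurable (Mx d) \<Longrightarrow>
       (\<integral>\<^sup>+ z. ennreal (a l (fst z)) * F (fst z) \<partial>P) = ennreal (\<alpha> l) * (\<integral>\<^sup>+ x. F x \<partial>\<mu>s l)"
    and F: "is_lipschitz d L F" "0 < L" "\<And>x. \<bar>F x\<bar> \<le> 1" and c: "0 < c" and d: "0 < d"
  shows "(\<integral>\<^sup>+ z. ennreal (exp (real d / (4 * c * L\<^sup>2) *
            (\<Sum>l<k. a l (fst z) * (F (fst z) - (\<integral>x. F x \<partial>\<mu>s l))\<^sup>2))) \<partial>P) \<le> ennreal (exp 3)"
proof -
  have [measurable]: "fst \<in> measurable P (Mx d)"
    by (subst measurable_cong_sets[OF sP refl]) simp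
  have [measurable]: "F \<in> borel_measurable (Mx d)" using F by (intro is_lipschitz_measurable[of d L]) auto
  define \<kappa> where "\<kappa> = real d / (4 * c * L\<^sup>2)"
  define V where "V l x = \<kappa> * (F x - (\<integral>x. F x \<partial>\<mu>s l))\<^sup>2" for l x
  have [measurable]: "V l \<in> borel_measurable (Mx d)" for l unfolding V_def by measurable
  have "(\<integral>\<^sup>+ z. ennreal (exp (\<kappa> * (\<Sum>l<k. a l (fst z) * (F (fst z) - (\<integral>x. F x \<partial>\<mu>s l))\<^sup>2))) \<partial>P)
      \<le> (\<integral>\<^sup>+ z. (\<Sum>l<k. ennreal (a l (fst z)) * ennreal (exp (V l (fst z)))) \<partial>P)"
  proof (rule nn_integral_mono)
    fix z :: "(nat \<Rightarrow> real) \<times> real"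
    have "exp (\<kappa> * (\<Sum>l<k. a l (fst z) * (F (fst z) - (\<integral>x. F x \<partial>\<mu>s l))\<^sup>2)) = exp (\<Sum>l<k. a l (fst z) * V l (fst z))"
      by (simp add: V_def sum_distrib_left mult_ac)
    also have "\<dots> \<le> (\<Sum>l<k. a l (fst z) * exp (V l (fst z)))"
      by (rule exp_weighted_mean_le) (auto simp: a0 a1)
    finally have "ennreal (exp (\<kappa> * (\<Sum>l<k. a l (fst z) * (F (fst z) - (\<integral>x. F x \<partial>\<mu>s l))\<^sup>2)))
        \<le> ennreal (\<Sum>l<k. a l (fst z) * exp (V l (fst z)))" by (rule ennreal_leI)
    also have "\<dots> = (\<Sum>l<k. ennreal (a l (fst z)) * ennreal (exp (V l (fst z))))"
      by (simp add: a0 ennreal_mult[symmetric] sum_ennreal)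
    finally show "ennreal (exp (\<kappa> * (\<Sum>l<k. a l (fst z) * (F (fst z) - (\<integral>x. F x \<partial>\<mu>s l))\<^sup>2)))
        \<le> (\<Sum>l<k. ennreal (a l (fst z)) * ennreal (exp (V l (fst z))))" .
  qed
  also have "\<dots> = (\<Sum>l<k. \<integral>\<^sup>+ z. ennreal (a l (fst z)) * ennreal (exp (V l (fst z))) \<partial>P)"
  proof (rule nn_integral_sum)
    fix l assume "l \<in> {..<k}"
    then have [measurable]: "a l \<in> borel_measurable (Mx d)" by (intro am) simp
    show "(\<lambda>z. ennreal (a l (fst z)) * ennreal (exp (V l (fst z)))) \<in> borel_measurable P" by measurable
  qed
  also have "\<dots> = (\<Sum>l<k. ennreal (\<alpha> l) * (\<integral>\<^sup>+ x. ennreal (exp (V l x)) \<partial>\<mu>s l))"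
    by (intro sum.cong refl aint) auto
  also have "\<dots> \<le> (\<Sum>l<k. ennreal (\<alpha> l) * ennreal (exp 3))"
  proof (intro sum_mono mult_left_mono)
    fix l assume "l \<in> {..<k}"
    then have l: "l < k" by simp
    show "(\<integral>\<^sup>+ x. ennreal (exp (V l x)) \<partial>\<mu>s l) \<le> ennreal (exp 3)"
      unfolding V_def \<kappa>_def using mu[OF l] F c d by (intro isoperimetric_exp_moment) auto
  qed auto
  also have "\<dots> = (\<Sum>l<k. ennreal (\<alpha> l)) * ennreal (exp 3)" by (simp add: sum_distrib_right)
  also have "(\<Sum>l<k. ennreal (\<alpha> l)) = ennreal (\<Sum>l<k. \<alpha> l)" using mu by (intro sum_ennreal) auto
  also have "\<dots> = 1" by (simp add: sum1)
  finally show ?thesis by (simp add: \<kappa>_def)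
qed

text \<open>\<open>K\<close> is the entropy up to the factor 5, which lets the general and the
  sparse case share one argument. Covers are demanded of every subset of \<open>W\<close>, because
  the net is drawn from the Lipschitz members and has to stay among them.\<close>

lemma robust_whp_of_cover:
  fixes P :: "((nat \<Rightarrow> real) \<times> real) measure"
  assumes eps: "0 < \<epsilon>" "\<epsilon> < 1" and del: "0 < \<delta>" "\<delta> < 1" and c: "0 < c"
    and "prob_space P" and sP[measurable_cong]: "sets P = sets (Mx d \<Otimes>\<^sub>M borel)"
    and y: "AE z in P. snd z \<in> {-1..1}"
    and mu: "\<And>l. l < k \<Longrightarrow> prob_space (\<mu>s l) \<and> sets (\<mu>s l) = sets (Mx d)
              \<and> isoperimetric d c (\<mu>s l) \<and> 0 \<le> \<alpha> l"
    and sum1: "(\<Sum>l<k. \<alpha> l) = (1::real)"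
    and mix: "\<And>A. A \<in> sets (Mx d) \<Longrightarrow> measure (distr P (Mx d) fst) A = (\<Sum>l<k. \<alpha> l * measure (\<mu>s l) A)"
    and nk: "10^4 * real k * ln (8 * real k / \<delta>) \<le> real n * \<epsilon>^2"
    and cover: "\<And>V. V \<subseteq> W \<Longrightarrow> \<exists>Q\<subseteq>V. finite Q \<and> real (card Q) \<le> exp (5 * K) \<and>
         (\<forall>w\<in>V. \<exists>q\<in>Q. \<forall>x\<in>RR d. \<bar>fw w x - fw q x\<bar> \<le> \<epsilon> / 60)"
    and K: "0 \<le> K"
    and s2: "0 < noise_level d P"
    and L2: "L\<^sup>2 = \<epsilon>\<^sup>2 * real n * real d / (noise_level d P * 2560 * c * (K + ln (4 / \<delta>)))"
    and dL: "1536 * c * L\<^sup>2 * noise_level d P / \<epsilon>\<^sup>2 \<le> real d"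
  shows "robust_whp d n P W fw (noise_level d P) \<epsilon> \<delta> L"
proof (cases "L \<le> 0 \<or> noise_level d P < \<epsilon>")
  case True
  then show ?thesis using assms by (intro robust_whp_trivial) auto
next
  case False
  define s2 where "s2 = noise_level d P"
  have s2: "0 < s2" "\<epsilon> \<le> s2" using s2 False by (auto simp: s2_def)
  have L: "0 < L" using False by simp
  \<comment> \<open>By the formula for \<open>L^2\<close>, a positive \<open>L\<close> excludes
    \<open>d = 0\<close> and \<open>n = 0\<close>.\<close>
  then have "L\<^sup>2 \<noteq> 0" by simp
  then have d: "0 < d" and n: "0 < n" using L2 by (auto intro!: gr0I)
  have k: "0 < k" using sum1 by (cases k) auto
  interpret P: prob_space P by fact
  let ?Q = "PiM {..<n} (\<lambda>_. P)"
  interpret Q: prob_space ?Q using P.prob_space_axioms by (intro prob_space_PiM)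
  have fstm[measurable]: "fst \<in> measurable P (Mx d)"
    by (subst measurable_cong_sets[OF sP refl]) simp
  have sndm[measurable]: "snd \<in> borel_measurable P"
    by (subst measurable_cong_sets[OF sP refl]) simp
  have mu': "prob_space (\<mu>s l) \<and> sets (\<mu>s l) = sets (Mx d) \<and> 0 \<le> \<alpha> l" if "l < k" for l
    using mu[OF that] by blast
  obtain a where am: "\<And>l. l < k \<Longrightarrow> a l \<in> borel_measurable (Mx d)"
    and a0: "\<And>l x. 0 \<le> a l x" and a1: "\<And>x. (\<Sum>l<k. a l x) = 1"
    and aint: "\<And>l F. l < k \<Longrightarrow> F \<in> borel_measurable (Mx d) \<Longrightarrow>
       (\<integral>\<^sup>+ z. ennreal (a l (fst z)) * F (fst z) \<partial>P) = ennreal (\<alpha> l) * (\<integral>\<^sup>+ x. F x \<partial>\<mu>s l)"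
    using mixture_weights[OF P.prob_space_axioms sP mu' sum1 mix] by blast
  obtain g where gF: "g \<in> borel_measurable (Fx d P)" and gm[measurable]: "g \<in> borel_measurable P"
    and g1: "\<And>z. \<bar>g z\<bar> \<le> 1"
    and orth: "\<And>h B. h \<in> borel_measurable (Fx d P) \<Longrightarrow> (\<And>z. \<bar>h z\<bar> \<le> B) \<Longrightarrow>
       (\<integral>z. (snd z - g z) * h z \<partial>P) = 0"
    and gs2: "(\<integral>z. (snd z - g z)\<^sup>2 \<partial>P) = s2"
    using regression_function[OF P.prob_space_axioms sP y] unfolding s2_def by blast
  define Z where "Z z = snd z - g z" for z
  have Zm[measurable]: "Z \<in> borel_measurable P" unfolding Z_def by measurable
  have Z2: "AE z in P. \<bar>Z z\<bar> \<le> 2" using y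
  proof eventually_elim
    fix z :: "(nat \<Rightarrow> real) \<times> real" assume "snd z \<in> {-1..1}"
    then show "\<bar>Z z\<bar> \<le> 2" using g1[of z] by (auto simp: Z_def)
  qed
  have EZ: "(\<integral>z. (Z z)\<^sup>2 \<partial>P) = s2" using gs2 by (simp add: Z_def)
  \<comment> \<open>With this tilt, \<open>nk\<close> says
    \<open>ln (8 * k / \<delta>) \<le> lam^2 * n / k\<close>; it explains the constant
    \<open>10^4\<close>.\<close>
  define lam where "lam = \<epsilon> / 100"
  have mgf_b: "(\<integral>\<^sup>+ z. ennreal (exp (l * (b z * Z z) - 4 * l\<^sup>2 * (b z)\<^sup>2)) \<partial>P) \<le> ennreal (exp 0)"
    if bF: "b \<in> borel_measurable (Fx d P)" and bP: "b \<in> borel_measurable P" and b1: "\<And>z. \<bar>b z\<bar> \<le> 1"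
      and l: "\<bar>l\<bar> = lam" for b and l :: real
  proof (rule P.mgf_orthogonal_le[OF Zm bP Z2 b1])
    show l2: "\<bar>l\<bar> \<le> 1/2" using l eps by (simp add: lam_def)
    show "(\<integral>z. Z z * (l * b z * exp (- 4 * l\<^sup>2 * (b z)\<^sup>2)) \<partial>P) = 0"
      unfolding Z_def
    proof (rule orth)
      show "(\<lambda>z. l * b z * exp (- 4 * l\<^sup>2 * (b z)\<^sup>2)) \<in> borel_measurable (Fx d P)" using bF by measurable
      fix z
      have "\<bar>l\<bar> * \<bar>b z\<bar> * exp (- 4 * l\<^sup>2 * (b z)\<^sup>2) \<le> 1 * 1 * 1"
        using l2 b1[of z] by (intro mult_mono) auto
      then show "\<bar>l * b z * exp (- 4 * l\<^sup>2 * (b z)\<^sup>2)\<bar> \<le> 1" by (simp add: abs_mult)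
    qed
  qed
  define ev where "ev \<phi> t = {S \<in> space ?Q. t \<le> (\<Sum>i<n. \<phi> (S i))}" for \<phi> :: "(nat \<Rightarrow> real) \<times> real \<Rightarrow> real" and t
  have evm: "ev \<phi> t \<in> sets ?Q" if "\<phi> \<in> borel_measurable P" for \<phi> t
    unfolding ev_def using that by measurable
  have evp: "measure ?Q (ev \<phi> t) \<le> b"
    if "\<phi> \<in> borel_measurable P" "(\<integral>\<^sup>+ z. ennreal (exp (\<phi> z)) \<partial>P) \<le> ennreal (exp M)" "exp (real n * M - t) \<le> b"
    for \<phi> M t b
    unfolding ev_def using prob_sum_ge_le_exp(2)[OF P.prob_space_axioms that(1,2), of n t] that(3) by simp
  have ln8k: "0 \<le> ln (8 * real k / \<delta>)" using k del by (simp add: ln_ge_zero_iff field_simps)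
  have ln8: "10^4 * ln (8 / \<delta>) \<le> real n * \<epsilon>\<^sup>2"
  proof -
    have "ln (8 / \<delta>) \<le> ln (8 * real k / \<delta>)" using k del by (simp add: divide_right_mono)
    also have "\<dots> \<le> real k * ln (8 * real k / \<delta>)" using k ln8k by (simp add: mult_le_cancel_right1)
    finally show ?thesis using nk by simp
  qed
  have ln80: "0 \<le> ln (8 / \<delta>)" using del by (simp add: ln_ge_zero_iff field_simps)
  have eln8: "exp (- ln (8 / \<delta>)) = \<delta> / 8" using del by (simp add: exp_minus)
  have eln8k: "exp (- ln (8 * real k / \<delta>)) = \<delta> / (8 * real k)" using del k by (simp add: exp_minus)
  \<comment> \<open>The tilt \<epsilon>/200 yields the exponent \<open>n * \<epsilon>^2\<close>
    times 16/40000 - 1/1200 = -13/30000, which is below -1/10000 as \<open>ln8\<close>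
    requires.\<close>
  define t1 where "t1 = - (\<epsilon> / 200) * (real n * (s2 - \<epsilon> / 6))"
  define \<phi>1 where "\<phi>1 z = - (\<epsilon> / 200) * (Z z)\<^sup>2" for z
  have m1[measurable]: "\<phi>1 \<in> borel_measurable P" unfolding \<phi>1_def by measurable
  have p1: "measure ?Q (ev \<phi>1 t1) \<le> \<delta> / 8"
  proof (rule evp[OF m1])
    show "(\<integral>\<^sup>+ z. ennreal (exp (\<phi>1 z)) \<partial>P) \<le> ennreal (exp (- (\<epsilon> / 200) * s2 + 16 * (\<epsilon> / 200)\<^sup>2))"
      unfolding \<phi>1_def using P.mgf_square_lower[OF Zm Z2, of "\<epsilon> / 200"] eps by (simp add: EZ)
    have "real n * (- (\<epsilon> / 200) * s2 + 16 * (\<epsilon> / 200)\<^sup>2) - t1 = - (13 / 30000) * (real n * \<epsilon>\<^sup>2)"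
      by (simp add: t1_def power2_eq_square algebra_simps)
    also have "\<dots> \<le> - ln (8 / \<delta>)" using ln8 ln80 by simp
    finally show "exp (real n * (- (\<epsilon> / 200) * s2 + 16 * (\<epsilon> / 200)\<^sup>2) - t1) \<le> \<delta> / 8"
      unfolding eln8[symmetric] by simp
  qed
  \<comment> \<open>Only a very negative correlation of \<open>g\<close> with the noise does harm,
    so one sign suffices.\<close>
  define \<phi>2 where "\<phi>2 z = (- lam) * (g z * Z z) - 4 * (- lam)\<^sup>2 * (g z)\<^sup>2" for z
  have m2[measurable]: "\<phi>2 \<in> borel_measurable P" unfolding \<phi>2_def by measurable
  have p2: "measure ?Q (ev \<phi>2 (ln (8 / \<delta>))) \<le> \<delta> / 8"
  proof (rule evp[OF m2])
    show "(\<integral>\<^sup>+ z. ennreal (exp (\<phi>2 z)) \<partial>P) \<le> ennreal (exp 0)"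
      unfolding \<phi>2_def using eps by (intro mgf_b gF gm g1) (simp add: lam_def)
  qed (simp add: eln8)
  define \<phi>3 where "\<phi>3 z = (Z z)\<^sup>2 / 4" for z
  have m3[measurable]: "\<phi>3 \<in> borel_measurable P" unfolding \<phi>3_def by measurable
  have p3: "measure ?Q (ev \<phi>3 (real n * s2)) \<le> \<delta> / 8"
  proof (rule evp[OF m3])
    show "(\<integral>\<^sup>+ z. ennreal (exp (\<phi>3 z)) \<partial>P) \<le> ennreal (exp (s2 / 2))"
      unfolding \<phi>3_def using P.mgf_square_upper[OF Zm Z2] by (simp add: EZ)
    \<comment> \<open>The exponent of this event is in terms of \<open>s2\<close>, whereas
      \<open>nk\<close> speaks of \<epsilon>^2; the reduction to \<open>\<epsilon> \<le> s2\<close>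
      links the two.\<close>
    have "\<epsilon>\<^sup>2 \<le> s2" using eps s2 by (simp add: power2_eq_square) (smt (verit) mult_left_le)
    then have "real n * \<epsilon>\<^sup>2 \<le> real n * s2" by (intro mult_left_mono) auto
    then have "real n * (s2 / 2) - real n * s2 \<le> - ln (8 / \<delta>)" using ln8 ln80 by (simp add: mult.commute)
    then show "exp (real n * (s2 / 2) - real n * s2) \<le> \<delta> / 8" unfolding eln8[symmetric] by simp
  qed
  define \<phi>4 where "\<phi>4 l r z = r * (a l (fst z) * Z z) - 4 * r\<^sup>2 * (a l (fst z))\<^sup>2" for l and r :: real and z
  have aP: "(\<lambda>z. a l (fst z)) \<in> borel_measurable P" if "l < k" for l
    using am[OF that] by measurable
  have m4: "\<phi>4 l r \<in> borel_measurable P" if "l < k" for l r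
    using aP[OF that] unfolding \<phi>4_def by measurable
  have a_le: "\<bar>a l x\<bar> \<le> 1" if "l < k" for l x
  proof -
    have "a l x \<le> (\<Sum>l<k. a l x)" using a0 that by (intro member_le_sum) auto
    then show ?thesis using a0[of l x] a1[of x] by simp
  qed
  have p4: "measure ?Q (ev (\<phi>4 l r) (ln (8 * real k / \<delta>))) \<le> \<delta> / (8 * real k)" if l: "l < k" and r: "\<bar>r\<bar> = lam" for l r
  proof (rule evp[OF m4[OF l]])
    have "fst \<in> measurable (Fx d P) (Mx d)"
      unfolding Fx_def by (rule measurable_vimage_algebra1) (use measurable_space[OF fstm] in auto)
    then have "(\<lambda>z. a l (fst z)) \<in> borel_measurable (Fx d P)" using am[OF l] by measurable
    then show "(\<integral>\<^sup>+ z. ennreal (exp (\<phi>4 l r z)) \<partial>P) \<le> ennreal (exp 0)"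
      unfolding \<phi>4_def by (intro mgf_b aP l a_le r)
  qed (simp add: eln8k)
  define V where "V = {w \<in> W. is_lipschitz d L (fw w)}"
  obtain N where N: "N \<subseteq> V" "finite N" "real (card N) \<le> exp (5 * K)"
    and Nc: "\<And>w. w \<in> V \<Longrightarrow> \<exists>q\<in>N. \<forall>x\<in>RR d. \<bar>fw w x - fw q x\<bar> \<le> \<epsilon> / 60"
    using cover[of V] unfolding V_def by blast
  define F where "F w x = clip (fw w x)" for w x
  have F1: "\<bar>F w x\<bar> \<le> 1" for w x by (simp add: F_def abs_clip_le)
  have FL: "is_lipschitz d L (F w)" if "w \<in> V" for w
    using that is_lipschitz_clip unfolding V_def F_def by blast
  have Fm: "F w \<in> borel_measurable (Mx d)" if "w \<in> V" for w
    using is_lipschitz_measurable[OF FL[OF that]] L by simp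
  define m where "m w l = (\<integral>x. F w x \<partial>\<mu>s l)" for w l
  have m_le: "\<bar>m w l\<bar> \<le> 1" if "w \<in> V" "l < k" for w l
  proof -
    interpret m: prob_space "\<mu>s l" using mu[OF that(2)] by simp
    have "F w \<in> borel_measurable (\<mu>s l)"
      using Fm[OF that(1)] mu[OF that(2)] by (simp cong: measurable_cong_sets)
    then show ?thesis unfolding m_def by (intro m.abs_integral_le_1 F1)
  qed
  define \<kappa> where "\<kappa> = real d / (4 * c * L\<^sup>2)"
  have \<kappa>: "0 < \<kappa>" using d c L by (simp add: \<kappa>_def)
  define H where "H w z = (\<Sum>l<k. a l (fst z) * (F w (fst z) - m w l)\<^sup>2)" for w and z :: "(nat \<Rightarrow> real) \<times> real"
  define \<phi>5 where "\<phi>5 w z = \<kappa> * H w z" for w z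
  have m5: "\<phi>5 w \<in> borel_measurable P" if "w \<in> V" for w
  proof -
    have [measurable]: "(\<lambda>z. F w (fst z)) \<in> borel_measurable P" using Fm[OF that] by measurable
    show ?thesis unfolding \<phi>5_def H_def
      by (intro borel_measurable_times borel_measurable_const borel_measurable_sum aP) (auto intro: aP)
  qed
  define b where "b = \<kappa> * \<epsilon>\<^sup>2 / (64 * s2)"
  \<comment> \<open>Unfolded, \<open>b = d * \<epsilon>^2 / (256 * c * L^2 * s2)\<close>, so this is
    the lower bound on \<open>d\<close>, with 1536 = 6 * 256. Half of \<open>n * b\<close> then pays
    for the moment bound \<open>exp (3 * n)\<close>.\<close>
  have b6: "6 \<le> b"
    using dL eps(1) s2(1) c L unfolding b_def \<kappa>_def s2_def[symmetric] by (simp add: field_simps)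
  \<comment> \<open>The other half pays for the net and for the confidence level; this fixes the
    constant 2560 = 5 * 512.\<close>
  have nb: "real n * b / 2 = 5 * (K + ln (4 / \<delta>))"
  proof -
    define X where "X = K + ln (4 / \<delta>)"
    have "0 < ln (4 / \<delta>)" using del by (simp add: ln_gt_zero_iff)
    then have X: "0 < X" using K by (simp add: X_def)
    have "L\<^sup>2 * (s2 * 2560 * c * X) = \<epsilon>\<^sup>2 * real n * real d"
      using L2 X s2 c by (simp add: X_def[symmetric] s2_def[symmetric])
    then show ?thesis using L c s2 X unfolding b_def \<kappa>_def X_def[symmetric]
      by (simp add: field_simps)
  qed
  have p5: "measure ?Q (ev (\<phi>5 w) (real n * b)) \<le> exp (- 5 * K) * (\<delta> / 4)" if w: "w \<in> V" for w
  proof (rule evp[OF m5[OF w]])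
    show "(\<integral>\<^sup>+ z. ennreal (exp (\<phi>5 w z)) \<partial>P) \<le> ennreal (exp 3)"
      unfolding \<phi>5_def \<kappa>_def H_def m_def
      by (rule mixture_exp_moment[where \<alpha>=\<alpha>, OF sP mu sum1 am a0 a1 aint FL[OF w] L F1 c d])
    have "real n * 3 \<le> real n * (b / 2)" using b6 by (intro mult_left_mono) auto
    then have "real n * 3 - real n * b \<le> - 5 * K - 5 * ln (4 / \<delta>)" using nb by simp
    also have "\<dots> \<le> - 5 * K - ln (4 / \<delta>)" using del by (simp add: ln_ge_zero_iff)
    finally have "exp (real n * 3 - real n * b) \<le> exp (- 5 * K - ln (4 / \<delta>))" by simp
    also have "\<dots> = exp (- 5 * K) * (\<delta> / 4)" using del by (simp add: exp_diff)
    finally show "exp (real n * 3 - real n * b) \<le> exp (- 5 * K) * (\<delta> / 4)" .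
  qed
  define E4 where "E4 = (\<Union>l<k. ev (\<phi>4 l lam) (ln (8 * real k / \<delta>)) \<union> ev (\<phi>4 l (- lam)) (ln (8 * real k / \<delta>)))"
  define E5 where "E5 = (\<Union>w\<in>N. ev (\<phi>5 w) (real n * b))"
  have E4m: "E4 \<in> sets ?Q" unfolding E4_def by (intro sets.finite_UN sets.Un evm m4) auto
  have E5m: "E5 \<in> sets ?Q" unfolding E5_def using N by (intro sets.finite_UN evm m5) auto
  have abs_lam: "\<bar>lam\<bar> = lam" "\<bar>- lam\<bar> = lam" using eps by (auto simp: lam_def)
  have P4: "measure ?Q E4 \<le> \<delta> / 4"
  proof -
    have "measure ?Q E4 \<le> (\<Sum>l<k. measure ?Q (ev (\<phi>4 l lam) (ln (8 * real k / \<delta>)) \<union> ev (\<phi>4 l (- lam)) (ln (8 * real k / \<delta>))))"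
      unfolding E4_def by (intro Q.finite_measure_subadditive_finite) (auto intro!: sets.Un evm m4)
    also have "\<dots> \<le> (\<Sum>l<k. \<delta> / (8 * real k) + \<delta> / (8 * real k))"
    proof (rule sum_mono)
      fix l assume "l \<in> {..<k}"
      then have l: "l < k" by simp
      show "measure ?Q (ev (\<phi>4 l lam) (ln (8 * real k / \<delta>)) \<union> ev (\<phi>4 l (- lam)) (ln (8 * real k / \<delta>)))
          \<le> \<delta> / (8 * real k) + \<delta> / (8 * real k)"
        using measure_Un_le[OF evm[OF m4[OF l]] evm[OF m4[OF l]]] p4[OF l abs_lam(1)] p4[OF l abs_lam(2)]
        by (meson add_mono order_trans)
    qed
    also have "\<dots> = \<delta> / 4" using k by (simp add: field_simps)
    finally show ?thesis .
  qed
  have P5: "measure ?Q E5 \<le> \<delta> / 4"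
  proof -
    have "measure ?Q E5 \<le> (\<Sum>w\<in>N. measure ?Q (ev (\<phi>5 w) (real n * b)))"
      unfolding E5_def using N by (intro Q.finite_measure_subadditive_finite) (auto intro!: evm m5)
    also have "\<dots> \<le> (\<Sum>w\<in>N. exp (- 5 * K) * (\<delta> / 4))" using N(1) by (intro sum_mono p5) auto
    also have "\<dots> = real (card N) * (exp (- 5 * K) * (\<delta> / 4))" by simp
    also have "\<dots> \<le> exp (5 * K) * (exp (- 5 * K) * (\<delta> / 4))"
      using N(3) del by (intro mult_right_mono) auto
    also have "\<dots> = \<delta> / 4" by (simp add: exp_minus)
    finally show ?thesis .
  qed
  \<comment> \<open>The failure budget is three times \<delta>/8 plus twice \<delta>/4, that is 7/8
    of \<delta>.\<close>
  define E where "E = ev \<phi>1 t1 \<union> (ev \<phi>2 (ln (8 / \<delta>)) \<union> (ev \<phi>3 (real n * s2) \<union> (E4 \<union> E5)))"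
  have e123: "ev \<phi>1 t1 \<in> sets ?Q" "ev \<phi>2 (ln (8 / \<delta>)) \<in> sets ?Q" "ev \<phi>3 (real n * s2) \<in> sets ?Q"
    by (auto intro!: evm)
  have Em: "E \<in> sets ?Q" unfolding E_def using e123 E4m E5m by blast
  have PE: "measure ?Q E \<le> \<delta>"
  proof -
    have "measure ?Q E \<le> measure ?Q (ev \<phi>1 t1) + (measure ?Q (ev \<phi>2 (ln (8 / \<delta>)))
        + (measure ?Q (ev \<phi>3 (real n * s2)) + (measure ?Q E4 + measure ?Q E5)))"
      unfolding E_def using e123 E4m E5m
      by (intro order_trans[OF measure_Un_le] add_left_mono) auto
    also have "\<dots> \<le> \<delta>" using p1 p2 p3 P4 P5 del by simp
    finally show ?thesis .
  qed
  \<comment> \<open>The conclusion concerns every sample in \<open>A\<close>, so the almost sure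
    bound on the labels is built into the event.\<close>
  define A where "A = {S \<in> space ?Q. \<forall>i\<in>{..<n}. snd (S i) \<in> {-1..1}} - E"
  have Am: "A \<in> sets ?Q" unfolding A_def using Em by measurable
  have "AE S in ?Q. \<forall>i\<in>{..<n}. snd (S i) \<in> {-1..1}"
  proof (intro eventually_ball_finite ballI)
    fix i assume "i \<in> {..<n}"
    then show "AE S in ?Q. snd (S i) \<in> {-1..1}"
      by (rule AE_PiM_component[rotated]) (use y P.prob_space_axioms in auto)
  qed simp
  then have "AE S in ?Q. S \<in> A \<longleftrightarrow> S \<in> space ?Q - E"
    using AE_space by eventually_elim (auto simp: A_def)
  then have "measure ?Q A = measure ?Q (space ?Q - E)"
    using Am Em by (intro measure_eq_AE) auto
  also have "\<dots> \<ge> 1 - \<delta>" using Q.prob_compl[OF Em] PE by simp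
  finally have PA: "1 - \<delta> \<le> measure ?Q A" .
  have main: "ereal L \<le> Lip d (fw w)"
    if S: "S \<in> A" and w: "w \<in> W"
      and fit: "1 / real n * (\<Sum>i<n. (fw w (fst (S i)) - snd (S i))\<^sup>2) \<le> s2 - \<epsilon>" for S w
  proof (rule ccontr)
    assume "\<not> ?thesis"
    then have "Lip d (fw w) < ereal L" by simp
    then have wV: "w \<in> V" using is_lipschitz_of_Lip_less w by (simp add: V_def)
    obtain q where q: "q \<in> N" and wq: "\<And>x. x \<in> RR d \<Longrightarrow> \<bar>fw w x - fw q x\<bar> \<le> \<epsilon> / 60"
      using Nc[OF wV] by blast
    have qV: "q \<in> V" using q N(1) by blast
    have SQ: "S \<in> space ?Q" and Sy: "\<And>i. i < n \<Longrightarrow> \<bar>snd (S i)\<bar> \<le> 1" and SE: "S \<notin> E"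
      using S by (auto simp: A_def abs_le_iff)
    have SP: "S i \<in> space P" if "i < n" for i using SQ that by (auto simp: space_PiM)
    have SR: "fst (S i) \<in> RR d" if "i < n" for i
      using measurable_space[OF fstm SP[OF that]] by (simp add: space_Mx)
    have not_ev: "(\<Sum>i<n. \<phi> (S i)) < t" if "S \<notin> ev \<phi> t" for \<phi> t
      using that SQ by (simp add: ev_def)
    have lam0: "0 < lam" using eps by (simp add: lam_def)
    have "real n * (s2 - \<epsilon>) < (\<Sum>i<n. (F w (fst (S i)) - snd (S i))\<^sup>2)"
    proof (rule no_fit_below_noise[OF n eps(1) s2(1) k, where g="\<lambda>i. g (S i)" and q="\<lambda>i. F q (fst (S i))"
          and a="\<lambda>l i. a l (fst (S i))" and m="m q"])
      show "\<bar>snd (S i)\<bar> \<le> 1" if "i < n" for i using Sy[OF that] .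
      show "\<bar>g (S i)\<bar> \<le> 1" for i by (rule g1)
      show "\<bar>F w (fst (S i)) - F q (fst (S i))\<bar> \<le> \<epsilon> / 60" if "i < n" for i
        unfolding F_def by (rule order_trans[OF abs_clip_diff_le wq[OF SR[OF that]]])
      show "0 \<le> a l (fst (S i))" for l i by (rule a0)
      show "(\<Sum>l<k. a l (fst (S i))) = 1" for i by (rule a1)
      show "\<bar>m q l\<bar> \<le> 1" if "l < k" for l using m_le[OF qV that] .
      have "- (\<epsilon> / 200) * (\<Sum>i<n. (Z (S i))\<^sup>2) < t1"
        using not_ev[of \<phi>1 t1] SE by (simp add: E_def \<phi>1_def sum_distrib_left sum_negf)
      then show "real n * (s2 - \<epsilon> / 6) < (\<Sum>i<n. (snd (S i) - g (S i))\<^sup>2)"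
        unfolding t1_def mult_minus_left neg_less_iff_less Z_def using eps(1)
        by (subst (asm) mult_less_cancel_left_pos) auto
      show "(\<Sum>i<n. (snd (S i) - g (S i))\<^sup>2) < 4 * real n * s2"
        using not_ev[of \<phi>3 "real n * s2"] SE by (simp add: E_def \<phi>3_def Z_def sum_divide_distrib[symmetric])
      have "- lam * (\<Sum>i<n. g (S i) * Z (S i)) - 4 * lam\<^sup>2 * (\<Sum>i<n. (g (S i))\<^sup>2) < ln (8 / \<delta>)"
        using not_ev[of \<phi>2 "ln (8 / \<delta>)"] SE by (simp add: E_def \<phi>2_def sum_subtractf sum_distrib_left sum_negf)
      moreover have "(\<Sum>i<n. (g (S i))\<^sup>2) \<le> (\<Sum>i<n. 1)"
        using g1 by (intro sum_mono) (simp add: abs_square_le_1)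
      then have "4 * lam\<^sup>2 * (\<Sum>i<n. (g (S i))\<^sup>2) \<le> 4 * lam\<^sup>2 * real n" by (intro mult_left_mono) auto
      moreover have "ln (8 / \<delta>) \<le> lam\<^sup>2 * real n" using ln8 by (simp add: lam_def power_divide mult.commute)
      \<comment> \<open>Four parts come from the compensator, as \<open>g^2 \<le> 1\<close>, and one
        from the logarithm; \<open>5 * lam\<close> is \<epsilon>/20.\<close>
      ultimately have "lam * (- (\<Sum>i<n. g (S i) * Z (S i))) \<le> lam * (5 * lam * real n)"
        by (simp add: power2_eq_square)
      then show "- (\<Sum>i<n. g (S i) * (snd (S i) - g (S i))) \<le> \<epsilon> / 20 * real n"
        using lam0 by (subst (asm) mult_le_cancel_left_pos) (auto simp: Z_def lam_def)
    next
      fix l assume l: "l < k"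
      define u where "u = (\<Sum>i<n. a l (fst (S i)) * Z (S i))"
      define v where "v = (\<Sum>i<n. (a l (fst (S i)))\<^sup>2)"
      \<comment> \<open>Both signs of the tilt enter, because the component means that multiply
        these correlations may have either sign.\<close>
      have "r * u - 4 * r\<^sup>2 * v < ln (8 * real k / \<delta>)" if "r = lam \<or> r = - lam" for r
      proof -
        have "S \<notin> ev (\<phi>4 l r) (ln (8 * real k / \<delta>))" using SE l that by (auto simp: E_def E4_def)
        from not_ev[OF this] show ?thesis
          by (simp add: \<phi>4_def u_def v_def sum_subtractf sum_distrib_left)
      qed
      from this[of lam] this[of "- lam"] have "lam * \<bar>u\<bar> \<le> 4 * lam\<^sup>2 * v + ln (8 * real k / \<delta>)"
        by (cases "0 \<le> u") auto
      also have "ln (8 * real k / \<delta>) \<le> lam\<^sup>2 * real n / real k"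
        using nk k by (simp add: lam_def field_simps)
      also have "4 * lam\<^sup>2 * v + lam\<^sup>2 * real n / real k = lam * (4 * lam * v + lam * real n / real k)"
        by (simp add: power2_eq_square algebra_simps)
      finally have "\<bar>u\<bar> \<le> 4 * lam * v + lam * real n / real k" using lam0 by simp
      then show "\<bar>\<Sum>i<n. a l (fst (S i)) * (snd (S i) - g (S i))\<bar>
          \<le> \<epsilon> / 25 * (\<Sum>i<n. (a l (fst (S i)))\<^sup>2) + \<epsilon> * real n / (100 * real k)"
        unfolding u_def v_def Z_def lam_def by simp
    next
      have "S \<notin> ev (\<phi>5 q) (real n * b)" using SE q by (auto simp: E_def E5_def)
      then have "\<kappa> * (\<Sum>i<n. H q (S i)) < real n * b"
        using not_ev by (fastforce simp: \<phi>5_def sum_distrib_left)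
      also have "\<dots> = \<kappa> * (real n * \<epsilon>\<^sup>2 / (64 * s2))" by (simp add: b_def)
      finally have "(\<Sum>i<n. H q (S i)) < real n * \<epsilon>\<^sup>2 / (64 * s2)" using \<kappa> by (simp only: mult_less_cancel_left_pos)
      then show "(\<Sum>i<n. \<Sum>l<k. a l (fst (S i)) * (F q (fst (S i)) - m q l)\<^sup>2) \<le> real n * \<epsilon>\<^sup>2 / (64 * s2)"
        by (simp add: H_def)
    qed
    also have "\<dots> \<le> (\<Sum>i<n. (fw w (fst (S i)) - snd (S i))\<^sup>2)"
      unfolding F_def using Sy by (intro sum_mono clip_square_le) auto
    finally show False using fit n by (simp add: field_simps)
  qed
  show ?thesis unfolding robust_whp_def s2_def[symmetric]
    by (intro bexI[OF _ Am] conjI ballI impI PA main)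
qed

lemma lipschitz_threshold:
  fixes L K s2 :: real
  assumes L: "L = \<epsilon> / (sqrt s2 * sqrt (C * c)) * sqrt (real n * real d / (K + ln (4 / \<delta>)))"
    and "0 < s2" "0 < C" "0 < c" "0 \<le> K" "0 < \<delta>" "\<delta> < 1"
  shows "L\<^sup>2 = \<epsilon>\<^sup>2 * real n * real d / (s2 * C * c * (K + ln (4 / \<delta>)))"
proof -
  have "0 < ln (4 / \<delta>)" using assms by (simp add: ln_gt_zero_iff)
  then have "0 \<le> real n * real d / (K + ln (4 / \<delta>))" using assms by simp
  then have "(sqrt (real n * real d / (K + ln (4 / \<delta>))))\<^sup>2 = real n * real d / (K + ln (4 / \<delta>))" by simp
  then show ?thesis using assms(2-4)
    unfolding L by (simp add: power_mult_distrib power_divide mult_ac)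
qed

theorem mainTheorem6:
  shows "\<exists>C1 C2 :: real. C1 > 0 \<and> C2 > 0 \<and>
   (\<forall>(d::nat) (p::nat) (n::nat) (k::nat) (s::nat) (c::real) (\<alpha>::nat \<Rightarrow> real)
      (\<mu>s :: nat \<Rightarrow> (nat \<Rightarrow> real) measure) (P :: ((nat \<Rightarrow> real) \<times> real) measure)
      (W :: (nat \<Rightarrow> real) set) (Wd::real) (J::real)
      (fw :: (nat \<Rightarrow> real) \<Rightarrow> (nat \<Rightarrow> real) \<Rightarrow> real) (\<epsilon>::real) (\<delta>::real).
     0 < \<epsilon> \<and> \<epsilon> < 1 \<and> 0 < \<delta> \<and> \<delta> < 1 \<and> 0 < c
     \<comment> \<open>data law: joint law of (x,y) on R^d x [-1,1]\<close>
     \<and> prob_space P \<and> sets P = sets (Mx d \<Otimes>\<^sub>M borel)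
     \<and> (AE z in P. snd z \<in> {-1..1})
     \<comment> \<open>(1) parametrized class\<close>
     \<and> W \<subseteq> {w. \<forall>i\<ge>p. w i = 0} \<and> 0 \<le> Wd \<and> 0 \<le> J
     \<and> (\<forall>w1\<in>W. \<forall>w2\<in>W. vnorm p (\<lambda>i. w1 i - w2 i) \<le> Wd)
     \<and> (\<forall>w1\<in>W. \<forall>w2\<in>W. \<forall>x\<in>RR d.
           \<bar>fw w1 x - fw w2 x\<bar> \<le> J * vnorm p (\<lambda>i. w1 i - w2 i))
     \<comment> \<open>(2) covariate law is a mixture of c-isoperimetric measures\<close>
     \<and> (\<forall>l<k. prob_space (\<mu>s l) \<and> sets (\<mu>s l) = sets (Mx d)
              \<and> isoperimetric d c (\<mu>s l) \<and> 0 \<le> \<alpha> l)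
     \<and> (\<Sum>l<k. \<alpha> l) = 1
     \<and> (\<forall>A\<in>sets (Mx d). measure (distr P (Mx d) fst) A = (\<Sum>l<k. \<alpha> l * measure (\<mu>s l) A))
     \<and> 10^4 * real k * ln (8 * real k / \<delta>) \<le> real n * \<epsilon>^2
     \<comment> \<open>(3) positive noise level\<close>
     \<and> noise_level d P > 0
     \<longrightarrow>
     (let \<sigma> = sqrt (noise_level d P);
          Lst = \<epsilon> / (\<sigma> * sqrt (C2 * c)) *
                sqrt (real n * real d / (real p * ln (1 + 60 * Wd * J / \<epsilon>) + ln (4 / \<delta>)));
          Lsp = \<epsilon> / (\<sigma> * sqrt (C2 * c)) *
                sqrt (real n * real d / (real s * ln (real p * (1 + 60 * Wd * J / \<epsilon>)) + ln (4 / \<delta>)))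
      in (real d \<ge> C1 * c * Lst^2 * \<sigma>^2 / \<epsilon>^2
            \<longrightarrow> robust_whp d n P W fw (\<sigma>^2) \<epsilon> \<delta> Lst)
       \<and> ((\<forall>w\<in>W. card {i. i < p \<and> w i \<noteq> 0} \<le> s)
            \<and> real d \<ge> C1 * c * Lsp^2 * \<sigma>^2 / \<epsilon>^2
            \<longrightarrow> robust_whp d n P W fw (\<sigma>^2) \<epsilon> \<delta> Lsp)))"
proof (rule exI[of _ 1536], rule exI[of _ 2560], intro conjI allI impI, goal_cases)
  case (3 d p n k s c \<alpha> \<mu>s P W Wd J fw \<epsilon> \<delta>)
  define s2 where "s2 = noise_level d P"
  define X where "X = 60 * Wd * J / \<epsilon>"
  have eps: "0 < \<epsilon>" "\<epsilon> < 1" and del: "0 < \<delta>" "\<delta> < 1" and c: "0 < c"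
    and P: "prob_space P" and sP: "sets P = sets (Mx d \<Otimes>\<^sub>M borel)"
    and y: "AE z in P. snd z \<in> {-1..1}"
    and Wp: "W \<subseteq> {w. \<forall>i\<ge>p. w i = 0}" and Wd: "0 \<le> Wd" and J: "0 \<le> J"
    and diam: "\<And>w1 w2. w1 \<in> W \<Longrightarrow> w2 \<in> W \<Longrightarrow> vnorm p (\<lambda>i. w1 i - w2 i) \<le> Wd"
    and par: "\<And>w1 w2 x. w1 \<in> W \<Longrightarrow> w2 \<in> W \<Longrightarrow> x \<in> RR d \<Longrightarrow>
           \<bar>fw w1 x - fw w2 x\<bar> \<le> J * vnorm p (\<lambda>i. w1 i - w2 i)"
    and mu: "\<And>l. l < k \<Longrightarrow> prob_space (\<mu>s l) \<and> sets (\<mu>s l) = sets (Mx d)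
              \<and> isoperimetric d c (\<mu>s l) \<and> 0 \<le> \<alpha> l"
    and sum1: "(\<Sum>l<k. \<alpha> l) = 1"
    and mix: "\<And>A. A \<in> sets (Mx d) \<Longrightarrow> measure (distr P (Mx d) fst) A = (\<Sum>l<k. \<alpha> l * measure (\<mu>s l) A)"
    and nk: "10^4 * real k * ln (8 * real k / \<delta>) \<le> real n * \<epsilon>^2"
    and s2: "0 < s2"
    using 3 by (simp_all add: s2_def)
  have X0: "0 \<le> X" using eps Wd J by (simp add: X_def)
  \<comment> \<open>The factor 60 in the theorem is the uniform radius \<epsilon>/60 to which the
    net must approximate a predictor.\<close>
  have XX: "Wd * J / (\<epsilon> / 60) = X" by (simp add: X_def)
  have \<eta>: "0 < \<epsilon> / 60" using eps by simp
  have sq: "(sqrt s2)\<^sup>2 = s2" using s2 by simp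
  have robust: "robust_whp d n P W fw s2 \<epsilon> \<delta> L"
    if L: "L = \<epsilon> / (sqrt s2 * sqrt (2560 * c)) * sqrt (real n * real d / (K + ln (4 / \<delta>)))"
      and dL: "1536 * c * L\<^sup>2 * s2 / \<epsilon>\<^sup>2 \<le> real d" and K: "0 \<le> K"
      and net: "\<And>V. V \<subseteq> W \<Longrightarrow> \<exists>Q\<subseteq>V. finite Q \<and> real (card Q) \<le> exp (5 * K) \<and>
         (\<forall>w\<in>V. \<exists>q\<in>Q. J * vnorm p (\<lambda>i. w i - q i) \<le> \<epsilon> / 60)" for L K
    unfolding s2_def
  proof (rule robust_whp_of_cover[OF eps del c P sP y mu sum1 mix nk _ K])
    show "\<exists>Q\<subseteq>V. finite Q \<and> real (card Q) \<le> exp (5 * K) \<and>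
         (\<forall>w\<in>V. \<exists>q\<in>Q. \<forall>x\<in>RR d. \<bar>fw w x - fw q x\<bar> \<le> \<epsilon> / 60)" if V: "V \<subseteq> W" for V
    proof -
      obtain Q where Q: "Q \<subseteq> V" "finite Q" "real (card Q) \<le> exp (5 * K)"
        and cov: "\<And>w. w \<in> V \<Longrightarrow> \<exists>q\<in>Q. J * vnorm p (\<lambda>i. w i - q i) \<le> \<epsilon> / 60"
        using net[OF V] by blast
      have "\<exists>q\<in>Q. \<forall>x\<in>RR d. \<bar>fw w x - fw q x\<bar> \<le> \<epsilon> / 60" if w: "w \<in> V" for w
      proof -
        obtain q where q: "q \<in> Q" "J * vnorm p (\<lambda>i. w i - q i) \<le> \<epsilon> / 60" using cov[OF w] ..
        have "w \<in> W" "q \<in> W" using w q(1) Q(1) V by auto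
        then have "\<forall>x\<in>RR d. \<bar>fw w x - fw q x\<bar> \<le> \<epsilon> / 60" using par q(2) order_trans by blast
        with q(1) show ?thesis by blast
      qed
      with Q show ?thesis by blast
    qed
    show "L\<^sup>2 = \<epsilon>\<^sup>2 * real n * real d / (noise_level d P * 2560 * c * (K + ln (4 / \<delta>)))"
      using lipschitz_threshold[OF L s2 _ c K del] by (simp add: s2_def)
  qed (use s2 dL in \<open>simp_all add: s2_def\<close>)
  have diamV: "vnorm p (\<lambda>i. v i - w i) \<le> Wd" if "V \<subseteq> W" "v \<in> V" "w \<in> V" for V v w
    using diam that by blast
  have dense: "\<exists>Q\<subseteq>V. finite Q \<and> real (card Q) \<le> exp (5 * (real p * ln (1 + X))) \<and>
         (\<forall>w\<in>V. \<exists>q\<in>Q. J * vnorm p (\<lambda>i. w i - q i) \<le> \<epsilon> / 60)" if V: "V \<subseteq> W" for V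
    by (rule dense_cover[OF Wd J \<eta> diamV[OF V], unfolded XX]) (assumption | intro exI conjI ballI)+
  have sparse: "\<exists>Q\<subseteq>V. finite Q \<and> real (card Q) \<le> exp (5 * (real s * ln (real p * (1 + X)))) \<and>
         (\<forall>w\<in>V. \<exists>q\<in>Q. J * vnorm p (\<lambda>i. w i - q i) \<le> \<epsilon> / 60)"
    if sp: "\<forall>w\<in>W. card {i. i < p \<and> w i \<noteq> 0} \<le> s" and V: "V \<subseteq> W" for V
  proof -
    have Vp: "V \<subseteq> {w. \<forall>i\<ge>p. w i = 0}" using V Wp by blast
    have spV: "card {i. i < p \<and> w i \<noteq> 0} \<le> s" if "w \<in> V" for w using sp V that by blast
    show ?thesis
      by (rule sparse_cover[OF Vp spV Wd J \<eta> diamV[OF V], unfolded XX]) (assumption | intro exI conjI ballI)+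
  qed
  have Kd: "0 \<le> real p * ln (1 + X)" using X0 by simp
  have Ks: "0 \<le> real s * ln (real p * (1 + X))"
  \<comment> \<open>For \<open>p = 0\<close> the value \<open>ln 0 = 0\<close> makes the entropy
    vanish; otherwise the argument of the logarithm is at least 1.\<close>
  proof (cases "p = 0")
    case False
    then have "1 * 1 \<le> real p * (1 + X)" using X0 by (intro mult_mono) auto
    then show ?thesis by (intro mult_nonneg_nonneg ln_ge_zero) auto
  qed simp
  show ?case
    unfolding Let_def s2_def[symmetric] X_def[symmetric] sq
  proof (intro conjI impI; (elim conjE)?)
    assume "1536 * c * (\<epsilon> / (sqrt s2 * sqrt (2560 * c)) *
      sqrt (real n * real d / (real p * ln (1 + X) + ln (4 / \<delta>))))\<^sup>2 * s2 / \<epsilon>\<^sup>2 \<le> real d"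
    then show "robust_whp d n P W fw s2 \<epsilon> \<delta> (\<epsilon> / (sqrt s2 * sqrt (2560 * c)) *
      sqrt (real n * real d / (real p * ln (1 + X) + ln (4 / \<delta>))))"
      by (rule robust[OF refl _ Kd dense])
  next
    assume sp: "\<forall>w\<in>W. card {i. i < p \<and> w i \<noteq> 0} \<le> s"
      and "1536 * c * (\<epsilon> / (sqrt s2 * sqrt (2560 * c)) *
      sqrt (real n * real d / (real s * ln (real p * (1 + X)) + ln (4 / \<delta>))))\<^sup>2 * s2 / \<epsilon>\<^sup>2 \<le> real d"
    then show "robust_whp d n P W fw s2 \<epsilon> \<delta> (\<epsilon> / (sqrt s2 * sqrt (2560 * c)) *
      sqrt (real n * real d / (real s * ln (real p * (1 + X)) + ln (4 / \<delta>))))"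
      by (intro robust[OF refl _ Ks sparse[OF sp]])
  qed
qed simp_all

end
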